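(* Let $\mathbf{k}$ be a field, let $s\ge 1$, and let $A=\mathbf{k}\langle x_1,\dots,x_s\rangle$ be the free associative algebra over $\mathbf{k}$ on $x_1,\dots,x_s$. Then every maximal commutative $\mathbf{k}$-subalgebra of $A$ is isomorphic, as a $\mathbf{k}$-algebra, to the ring of polynomials $\mathbf{k}[z]$ in one variable.
   Context: Algebras and subalgebras are unital and associative. A commutative $\mathbf{k}$-subalgebra of $A$ is called maximal if it is not properly contained in any other commutative $\mathbf{k}$-subalgebra of $A$. *)

theory Defs
  imports "HOL-Library.Poly_Mapping" "HOL-Computational_Algebra.Polynomial"
begin

section \<open>Algebras over a field\<close>

locale k_algebra = vector_space scale
  for scale :: "'k::field \<Rightarrow> 'a::ring_1 \<Rightarrow> 'a" +
  assumes scale_mult_left: "scale c x * y = scale c (x * y)"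
    and scale_mult_right: "x * scale c y = scale c (x * y)"
begin

definition subalgebra :: "'a set \<Rightarrow> bool" where
  "subalgebra B \<longleftrightarrow> subspace B \<and> 1 \<in> B \<and> (\<forall>x\<in>B. \<forall>y\<in>B. x * y \<in> B)"

definition commutative_subalgebra :: "'a set \<Rightarrow> bool" where
  "commutative_subalgebra B \<longleftrightarrow> subalgebra B \<and> (\<forall>x\<in>B. \<forall>y\<in>B. x * y = y * x)"

definition maximal_commutative_subalgebra :: "'a set \<Rightarrow> bool" where
  "maximal_commutative_subalgebra B \<longleftrightarrow>
     commutative_subalgebra B \<and> \<not> (\<exists>C. commutative_subalgebra C \<and> B \<subset> C)"

end

text \<open>Unital isomorphism of algebras, between subalgebras \<open>B\<close> and \<open>C\<close> given as carrier sets with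
  scalar multiplications \<open>s\<close> and \<open>t\<close> over the same field.\<close>

definition algebra_isomorphic ::
  "('k::field \<Rightarrow> 'a::ring_1 \<Rightarrow> 'a) \<Rightarrow> 'a set \<Rightarrow> ('k \<Rightarrow> 'b::ring_1 \<Rightarrow> 'b) \<Rightarrow> 'b set \<Rightarrow> bool" where
  "algebra_isomorphic s B t C \<longleftrightarrow>
     (\<exists>\<phi>. bij_betw \<phi> B C \<and> \<phi> 1 = 1 \<and>
        (\<forall>x\<in>B. \<forall>y\<in>B. \<phi> (x + y) = \<phi> x + \<phi> y) \<and>
        (\<forall>x\<in>B. \<forall>y\<in>B. \<phi> (x * y) = \<phi> x * \<phi> y) \<and>
        (\<forall>c. \<forall>x\<in>B. \<phi> (s c x) = t c (\<phi> x)))"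

interpretation poly_algebra: k_algebra "smult :: 'k::field \<Rightarrow> 'k poly \<Rightarrow> 'k poly"
  by unfold_locales (simp_all add: smult_add_right smult_add_left)


section \<open>The free associative algebra\<close>

text \<open>The free monoid, written additively because the convolution product of
  \<^type>\<open>poly_mapping\<close> is taken over a \<^class>\<open>monoid_add\<close>.\<close>

datatype 'a word = Word (letters: "'a list")

instantiation word :: (type) monoid_add
begin

definition zero_word :: "'a word" where "0 = Word []"

definition plus_word :: "'a word \<Rightarrow> 'a word \<Rightarrow> 'a word" where
  "u + v = Word (letters u @ letters v)"

instance by standard (simp_all add: zero_word_def plus_word_def)

end

text \<open>Finitely supported families of coefficients indexed by words, with the ring structure of
  \<^type>\<open>poly_mapping\<close>: the monoid algebra of the free monoid on \<open>'x\<close>. The generators are indexed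
  by the elements of \<open>'x\<close>, so a type \<open>'x\<close> of class \<^class>\<open>finite\<close> with \<open>s\<close> elements gives
  the free algebra on \<open>s\<close> generators (and \<open>s \<ge> 1\<close>, as types are nonempty).\<close>

type_synonym ('x, 'k) free_algebra = "'x word \<Rightarrow>\<^sub>0 'k"

definition free_var :: "'x \<Rightarrow> ('x, 'k::field) free_algebra" where
  "free_var i = Poly_Mapping.single (Word [i]) 1"

definition free_scale :: "'k::field \<Rightarrow> ('x, 'k) free_algebra \<Rightarrow> ('x, 'k) free_algebra" where
  "free_scale c f = Poly_Mapping.map ((*) c) f"

lemma lookup_free_scale:
  "Poly_Mapping.lookup (free_scale c f) w = c * Poly_Mapping.lookup f w"
  by (simp add: free_scale_def Poly_Mapping.map.rep_eq when_def)

lemma free_scale_eq_single_mult: "free_scale c f = Poly_Mapping.single 0 c * f"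
  by (simp add: free_scale_def mult_map_scale_conv_mult)

lemma sum_single_lookup:
  "f = (\<Sum>w\<in>Poly_Mapping.keys f. Poly_Mapping.single w (Poly_Mapping.lookup f w))"
  by (rule poly_mapping_eqI) (simp add: lookup_sum lookup_single when_def in_keys_iff)

lemma mult_single_zero_commute:
  fixes f :: "('x, 'k::field) free_algebra"
  shows "f * Poly_Mapping.single 0 c = Poly_Mapping.single 0 c * f"
proof -
  let ?s = "\<Sum>w\<in>Poly_Mapping.keys f. Poly_Mapping.single w (Poly_Mapping.lookup f w)"
  have "?s * Poly_Mapping.single 0 c = Poly_Mapping.single 0 c * ?s"
    by (simp add: sum_distrib_left sum_distrib_right mult_single mult.commute)
  then show ?thesis by (simp flip: sum_single_lookup)
qed

interpretation free_algebra:
  k_algebra "free_scale :: 'k::field \<Rightarrow> ('x, 'k) free_algebra \<Rightarrow> ('x, 'k) free_algebra"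
proof
  fix a b :: 'k and x y :: "('x, 'k) free_algebra"
  show "free_scale a (x + y) = free_scale a x + free_scale a y"
    by (rule poly_mapping_eqI) (simp add: lookup_free_scale lookup_add distrib_left)
  show "free_scale (a + b) x = free_scale a x + free_scale b x"
    by (rule poly_mapping_eqI) (simp add: lookup_free_scale lookup_add distrib_right)
  show "free_scale a (free_scale b x) = free_scale (a * b) x"
    by (rule poly_mapping_eqI) (simp add: lookup_free_scale mult.assoc)
  show "free_scale 1 x = x"
    by (rule poly_mapping_eqI) (simp add: lookup_free_scale)
  show "free_scale a x * y = free_scale a (x * y)"
    by (simp add: free_scale_eq_single_mult mult.assoc)
  show "x * free_scale a y = free_scale a (x * y)"
    by (metis free_scale_eq_single_mult mult.assoc mult_single_zero_commute)
qed

text \<open>The words are the noncommutative monomials in the generators, and every element is the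
  linear combination of monomials given by its coefficients.\<close>

lemma single_word_eq_prod_list:
  "Poly_Mapping.single w (1 :: 'k::field) = prod_list (map free_var (letters w))"
proof -
  have "Poly_Mapping.single (Word l) (1 :: 'k) = prod_list (map free_var l)" for l :: "'x list"
  proof (induction l)
    case Nil
    show ?case by (simp flip: zero_word_def)
  next
    case (Cons i l)
    have "Word (i # l) = Word [i] + Word l"
      by (simp add: plus_word_def)
    then have "Poly_Mapping.single (Word (i # l)) (1 :: 'k) =
        free_var i * Poly_Mapping.single (Word l) 1"
      by (simp add: free_var_def mult_single)
    then show ?case by (simp add: Cons.IH)
  qed
  from this[of "letters w"] show ?thesis by simp
qed

lemma free_algebra_expansion:
  fixes f :: "('x, 'k::field) free_algebra"
  shows "f = (\<Sum>w\<in>Poly_Mapping.keys f.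
    free_scale (Poly_Mapping.lookup f w) (prod_list (map free_var (letters w))))"
proof -
  have "Poly_Mapping.single w c = free_scale c (prod_list (map free_var (letters w)))"
    for w :: "'x word" and c :: 'k
    by (simp add: free_scale_eq_single_mult mult_single flip: single_word_eq_prod_list)
  then show ?thesis using sum_single_lookup[of f] by simp
qed

end

theory Submission
  imports Defs "HOL-Computational_Algebra.Polynomial_Factorial"
begin

text \<open>
  This is Bergman's centralizer theorem. A maximal commutative subalgebra is the centralizer \<open>Z\<close>
  of each of its non-scalar elements, once centralizers of non-scalar elements are known to be
  commutative.

  Read words as digit strings in base \<open>b\<close> and compare the values \<open>\<nu> w / (b ^ |w| - 1)\<close>
  of the periodic expansions \<open>0.www\<dots>\<close>. For finitely many given elements, let \<open>\<rho>\<close> be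
  the largest value of a nonempty word in their supports; the words of value at most \<open>\<rho>\<close> form a
  monoid, those of value exactly \<open>\<rho>\<close> a face of it with at most one word of each length, so that
  restricting coefficients to the face is a homomorphism \<open>\<phi>\<close> to \<open>k[t]\<close>. By the weak
  algorithm, elements of \<open>Z\<close> of equal degree are proportional up to lower degree, and this forces
  \<open>\<phi>\<close> to be injective on \<open>Z\<close>; hence \<open>Z\<close> is commutative.

  Let \<open>f \<in> Z\<close> have least positive degree, and let \<open>g \<in> Z\<close>. The commuting elements
  \<open>f - \<phi> f\<close> and \<open>g - \<phi> g\<close> of \<open>k[t]\<langle>X\<rangle>\<close> have a greatest common left divisor \<open>e\<close>,
  which is primitive over \<open>k[t]\<close>. Multiplication by \<open>c \<in> Z\<close> preserves the right ideal
  of \<open>e\<close>, so \<open>c e = e c'\<close>; as the leading coefficient of \<open>e\<close> in \<open>t\<close> is a scalar,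
  \<open>c' = c\<close>, and all coefficients of \<open>e\<close> in \<open>t\<close> lie in \<open>Z\<close>. The ideal is proper,
  because \<open>\<phi>\<close> extends semilinearly to the whole free algebra. So \<open>e\<close> has positive degree,
  hence that of \<open>f\<close> by minimality, and \<open>f - \<phi> f\<close> divides \<open>g - \<phi> g\<close>. Setting \<open>t = 0\<close> gives
  \<open>g - \<beta> = (f - \<alpha>) y\<close> with \<open>y \<in> Z\<close> of smaller degree, and \<open>Z = k[f]\<close> by induction.
\<close>

section \<open>Coefficients and length of words\<close>

abbreviation wlen :: "'x word \<Rightarrow> nat" where
  "wlen w \<equiv> length (letters w)"

abbreviation scalar :: "'r::zero \<Rightarrow> 'x word \<Rightarrow>\<^sub>0 'r" where
  "scalar c \<equiv> Poly_Mapping.single 0 c"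

abbreviation coef :: "('x word \<Rightarrow>\<^sub>0 'r::zero) \<Rightarrow> 'x word \<Rightarrow> 'r" where
  "coef \<equiv> Poly_Mapping.lookup"

lemma wlen_zero [simp]: "wlen 0 = 0"
  by (simp add: zero_word_def)

lemma wlen_plus [simp]: "wlen (u + v) = wlen u + wlen v"
  by (simp add: plus_word_def)

lemma letters_eq_Nil_iff [simp]: "letters w = [] \<longleftrightarrow> w = 0"
  by (cases w) (simp add: zero_word_def)

lemma plus_word_eq_append_iff: "w = Word (take i (letters w)) + q \<longleftrightarrow> q = Word (drop i (letters w))"
  by (cases w; cases q) (simp add: plus_word_def, metis append_take_drop_id same_append_eq)

lemma word_plus_right_cancel [simp]: "u + v = u' + v \<longleftrightarrow> u = u'" for u v :: "'x word"
  by (cases u; cases u'; cases v) (simp add: plus_word_def)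

text \<open>The factorizations of a word correspond to its cut positions, so the convolution over
  all pairs of words collapses to a finite sum over prefixes.\<close>

lemma coef_mult:
  fixes f g :: "'x word \<Rightarrow>\<^sub>0 'r::semiring_0"
  shows "coef (f * g) w =
    (\<Sum>i\<le>wlen w. coef f (Word (take i (letters w))) * coef g (Word (drop i (letters w))))"
proof -
  let ?t = "\<lambda>i. Word (take i (letters w))"
  let ?h = "\<lambda>l. coef f l * Sum_any (\<lambda>q. coef g q when w = l + q)"
  have sub: "{l. ?h l \<noteq> 0} \<subseteq> ?t ` {..wlen w}"
  proof
    fix l assume "l \<in> {l. ?h l \<noteq> 0}"
    then obtain q where "(coef g q when w = l + q) \<noteq> 0"
      by (metis (mono_tags, lifting) Sum_any.not_neutral_obtains_not_neutral mem_Collect_eq mult_zero_right)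
    then have "w = l + q"
      by (simp add: when_def split: if_splits)
    then have "l = ?t (wlen l)" "wlen l \<le> wlen w"
      by (cases l, simp add: plus_word_def)+
    then show "l \<in> ?t ` {..wlen w}" by blast
  qed
  have inj: "inj_on ?t {..wlen w}"
  proof (rule inj_onI)
    fix i j assume "i \<in> {..wlen w}" "j \<in> {..wlen w}" "?t i = ?t j"
    then show "i = j"
      by (metis atMost_iff length_take min.absorb2 word.inject)
  qed
  have "coef (f * g) w = Sum_any ?h"
    by (simp add: lookup_mult)
  also have "\<dots> = sum ?h (?t ` {..wlen w})"
    by (rule Sum_any.expand_superset[OF _ sub]) simp
  also have "\<dots> = (\<Sum>i\<le>wlen w. ?h (?t i))"
    by (simp add: sum.reindex[OF inj])
  also have "\<dots> = (\<Sum>i\<le>wlen w. coef f (?t i) * coef g (Word (drop i (letters w))))"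
    by (simp only: plus_word_eq_append_iff Sum_any_when_equal)
  finally show ?thesis .
qed

lemma coef_scalar_mult [simp]:
  fixes f :: "'x word \<Rightarrow>\<^sub>0 'r::semiring_0"
  shows "coef (scalar c * f) w = c * coef f w"
proof -
  have "coef (scalar c * f) w = (\<Sum>i\<le>wlen w. if i = 0 then c * coef f w else 0)"
    unfolding coef_mult
    by (rule sum.cong) (auto simp: lookup_single when_def zero_word_def)
  then show ?thesis by simp
qed

lemma coef_mult_scalar [simp]:
  fixes f :: "'x word \<Rightarrow>\<^sub>0 'r::semiring_0"
  shows "coef (f * scalar c) w = coef f w * c"
proof -
  have "coef (f * scalar c) w = (\<Sum>i\<le>wlen w. if i = wlen w then coef f w * c else 0)"
    unfolding coef_mult
    by (rule sum.cong) (auto simp: lookup_single when_def zero_word_def)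
  then show ?thesis by simp
qed

lemma scalar_central: "scalar c * f = f * scalar c" for c :: "'r::comm_semiring_0"
  by (rule poly_mapping_eqI) (simp add: mult.commute)

lemma scalar_left_commute: "f * (scalar c * g) = scalar c * (f * g)" for c :: "'r::comm_semiring_0"
  by (metis mult.assoc scalar_central)

lemma scalar_mult_scalar: "scalar c * scalar d = (scalar (c * d) :: 'x word \<Rightarrow>\<^sub>0 'r::semiring_0)"
  by (simp add: mult_single)

lemma scalar_add: "scalar (c + d) = (scalar c + scalar d :: 'x word \<Rightarrow>\<^sub>0 'r::comm_monoid_add)"
  by (simp add: single_add)

lemma scalar_eq_0_iff [simp]: "scalar c = (0 :: 'x word \<Rightarrow>\<^sub>0 'r::zero) \<longleftrightarrow> c = 0"
  by (metis lookup_single_eq lookup_zero single_zero)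

section \<open>Degree by word length\<close>

definition below :: "nat \<Rightarrow> ('x word \<Rightarrow>\<^sub>0 'r::zero) \<Rightarrow> bool" where
  "below n f \<longleftrightarrow> (\<forall>w. n \<le> wlen w \<longrightarrow> coef f w = 0)"

text \<open>The inserted 0 gives the zero element degree 0. Drops of degree are therefore stated
  with \<open>below\<close>, which zero satisfies for every bound.\<close>

definition wdeg :: "('x word \<Rightarrow>\<^sub>0 'r::zero) \<Rightarrow> nat" where
  "wdeg f = Max (insert 0 (wlen ` Poly_Mapping.keys f))"

lemma belowD: "below n f \<Longrightarrow> n \<le> wlen w \<Longrightarrow> coef f w = 0"
  by (simp add: below_def)

lemma below_0_iff [simp]: "below 0 f \<longleftrightarrow> f = 0"
  by (auto simp: below_def intro: poly_mapping_eqI)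

lemma below_zero [simp]: "below n 0"
  by (simp add: below_def)

lemma below_mono: "below n f \<Longrightarrow> n \<le> m \<Longrightarrow> below m f"
  by (auto simp: below_def)

lemma below_diff: "below n f \<Longrightarrow> below n g \<Longrightarrow> below n (f - g)"
  for f g :: "'x word \<Rightarrow>\<^sub>0 'r::ab_group_add"
  by (simp add: below_def lookup_minus)

lemma below_scalar_mult: "below n f \<Longrightarrow> below n (scalar c * f)"
  for f :: "'x word \<Rightarrow>\<^sub>0 'r::semiring_0"
  by (simp add: below_def)

lemma below_wdeg: "below (Suc (wdeg f)) f"
  unfolding below_def
proof (intro allI impI, rule ccontr)
  fix w assume "Suc (wdeg f) \<le> wlen w" "coef f w \<noteq> 0"
  then have "wlen w \<le> wdeg f"
    unfolding wdeg_def by (intro Max_ge) (auto simp: in_keys_iff)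
  with \<open>Suc (wdeg f) \<le> wlen w\<close> show False by simp
qed

lemma wdeg_witness:
  assumes "f \<noteq> 0"
  obtains w where "wlen w = wdeg f" "coef f w \<noteq> 0"
proof -
  have ne: "wlen ` Poly_Mapping.keys f \<noteq> {}" using assms by simp
  then have "wdeg f = Max (wlen ` Poly_Mapping.keys f)"
    by (simp add: wdeg_def)
  with ne have "wdeg f \<in> wlen ` Poly_Mapping.keys f"
    by (metis Max_in finite_imageI finite_keys)
  with that show thesis by (auto simp: in_keys_iff)
qed

lemma below_iff_wdeg_less: "f \<noteq> 0 \<Longrightarrow> below n f \<longleftrightarrow> wdeg f < n"
  by (metis belowD below_mono below_wdeg not_less wdeg_witness Suc_leI)

lemma wdeg_zero [simp]: "wdeg 0 = 0"
  by (simp add: wdeg_def)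

lemma le_wdeg: "coef f w \<noteq> 0 \<Longrightarrow> wlen w \<le> wdeg f"
  by (metis below_wdeg belowD not_less_eq_eq)

lemma wdeg_scalar [simp]: "wdeg (scalar c) = 0"
  by (simp add: wdeg_def)

lemma wdeg_0_imp_scalar: "wdeg f = 0 \<Longrightarrow> f = scalar (coef f 0)"
proof (rule poly_mapping_eqI)
  fix w assume "wdeg f = 0"
  then show "coef f w = coef (scalar (coef f 0)) w"
    using le_wdeg[of f w] by (cases "w = 0") (auto simp: lookup_single when_def)
qed

lemma wdeg_diff_less:
  fixes f g :: "'x word \<Rightarrow>\<^sub>0 'r::ab_group_add"
  assumes "below (wdeg f) (f - g)" and "f \<noteq> 0"
  shows "g \<noteq> 0" and "wdeg g = wdeg f"
proof -
  obtain w where w: "wlen w = wdeg f" "coef f w \<noteq> 0"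
    using wdeg_witness[OF \<open>f \<noteq> 0\<close>] .
  have eq: "coef g v = coef f v" if "wdeg f \<le> wlen v" for v
    using belowD[OF assms(1) that] by (simp add: lookup_minus)
  from eq[of w] w show nz: "g \<noteq> 0" by auto
  show "wdeg g = wdeg f"
  proof (rule antisym)
    show "wdeg f \<le> wdeg g" using eq[of w] w le_wdeg[of g w] by simp
    show "wdeg g \<le> wdeg f"
      by (metis eq le_wdeg linorder_le_cases nz wdeg_witness)
  qed
qed

text \<open>Cutting \<open>u + v\<close> anywhere but at \<open>wlen u\<close> makes one factor
  longer than \<open>u\<close> or \<open>v\<close>, so modulo \<pi> a single term survives. With
  \<pi> = 0 this is the product of leading coefficients.\<close>

lemma coef_mult_longest:
  fixes f g :: "'x word \<Rightarrow>\<^sub>0 'r::comm_semiring_1"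
  assumes f: "\<And>u'. wlen u < wlen u' \<Longrightarrow> \<pi> dvd coef f u'"
    and g: "\<And>v'. wlen v < wlen v' \<Longrightarrow> \<pi> dvd coef g v'"
  obtains r where "\<pi> dvd r" "coef (f * g) (u + v) = r + coef f u * coef g v"
proof -
  let ?h = "\<lambda>i. coef f (Word (take i (letters (u + v)))) * coef g (Word (drop i (letters (u + v))))"
  let ?I = "{..wlen (u + v)}"
  have mid: "?h (wlen u) = coef f u * coef g v"
    by (simp add: plus_word_def)
  have "coef (f * g) (u + v) = sum ?h (?I - {wlen u}) + ?h (wlen u)"
    unfolding coef_mult by (subst sum.remove[of _ "wlen u"]) (auto simp: add.commute)
  moreover have "\<pi> dvd sum ?h (?I - {wlen u})"
  proof (rule dvd_sum)
    fix i assume i: "i \<in> ?I - {wlen u}"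
    show "\<pi> dvd ?h i"
    proof (cases "i < wlen u")
      case True
      then show ?thesis using i by (intro dvd_mult g) auto
    next
      case False
      then show ?thesis using i by (intro dvd_mult2 f) auto
    qed
  qed
  ultimately show thesis by (intro that) (simp_all only: mid)
qed

lemma longest_word:
  assumes "P w" and "\<And>v. P v \<Longrightarrow> coef f v \<noteq> 0"
  obtains u where "P u" "\<And>v. wlen u < wlen v \<Longrightarrow> \<not> P v"
proof -
  let ?S = "wlen ` {v. P v}"
  have "{v. P v} \<subseteq> Poly_Mapping.keys f"
    using assms(2) by (auto simp: in_keys_iff)
  then have fin: "finite ?S"
    by (meson finite_imageI finite_keys finite_subset)
  then have "Max ?S \<in> ?S" using assms(1) by (intro Max_in) auto
  then obtain u where u: "P u" "wlen u = Max ?S" by auto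
  moreover have "\<not> P v" if "wlen u < wlen v" for v
    using Max_ge[OF fin, of "wlen v"] that u by auto
  ultimately show thesis using that by blast
qed

text \<open>Gauss's lemma: take longest words whose coefficients \<pi> does not divide and look at
  the coefficient of their concatenation. Over a domain the hypothesis admits \<pi> = 0, which
  yields the absence of zero divisors.\<close>

lemma prime_dvd_coef_mult:
  fixes f g :: "'x word \<Rightarrow>\<^sub>0 'r::comm_ring_1"
  assumes prime: "\<And>x y. \<pi> dvd x * y \<Longrightarrow> \<pi> dvd x \<or> \<pi> dvd y"
    and dvd: "\<And>w. \<pi> dvd coef (f * g) w"
  shows "(\<forall>w. \<pi> dvd coef f w) \<or> (\<forall>w. \<pi> dvd coef g w)"
proof (rule ccontr)
  assume "\<not> ?thesis"
  then obtain u v where "\<not> \<pi> dvd coef f u" "\<not> \<pi> dvd coef g v" by auto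
  moreover have "coef h w \<noteq> 0" if "\<not> \<pi> dvd coef h w" for h :: "'x word \<Rightarrow>\<^sub>0 'r" and w
    using that by auto
  ultimately obtain u v where
    u: "\<not> \<pi> dvd coef f u" "\<And>u'. wlen u < wlen u' \<Longrightarrow> \<pi> dvd coef f u'" and
    v: "\<not> \<pi> dvd coef g v" "\<And>v'. wlen v < wlen v' \<Longrightarrow> \<pi> dvd coef g v'"
    by (metis longest_word[of "\<lambda>w. \<not> \<pi> dvd coef f w"] longest_word[of "\<lambda>w. \<not> \<pi> dvd coef g w"])
  obtain r where "\<pi> dvd r" "coef (f * g) (u + v) = r + coef f u * coef g v"
    using coef_mult_longest[of u \<pi> f v g] u(2) v(2) by blast
  with dvd[of "u + v"] have "\<pi> dvd coef f u * coef g v"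
    by (simp add: dvd_add_right_iff)
  with prime u v show False by blast
qed

lemma free_mult_nonzero:
  fixes f g :: "'x word \<Rightarrow>\<^sub>0 'r::idom"
  assumes "f \<noteq> 0" "g \<noteq> 0"
  shows "f * g \<noteq> 0"
proof
  assume "f * g = 0"
  then have "(\<forall>w. coef f w = 0) \<or> (\<forall>w. coef g w = 0)"
    using prime_dvd_coef_mult[of 0 f g] by simp
  with assms show False by (metis lookup_zero poly_mapping_eqI)
qed

lemma free_mult_eq_0_iff: "f * g = 0 \<longleftrightarrow> f = 0 \<or> g = 0"
  for f g :: "'x word \<Rightarrow>\<^sub>0 'r::idom"
  using free_mult_nonzero by auto

lemma free_mult_left_cancel: "f \<noteq> 0 \<Longrightarrow> f * g = f * h \<longleftrightarrow> g = h"
  for f g :: "'x word \<Rightarrow>\<^sub>0 'r::idom"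
  using free_mult_eq_0_iff[of f "g - h"] by (simp add: algebra_simps)

lemma wdeg_mult:
  fixes f g :: "'x word \<Rightarrow>\<^sub>0 'r::idom"
  assumes "f \<noteq> 0" "g \<noteq> 0"
  shows "wdeg (f * g) = wdeg f + wdeg g"
proof (rule antisym)
  obtain w where w: "wlen w = wdeg (f * g)" "coef (f * g) w \<noteq> 0"
    using wdeg_witness[OF free_mult_nonzero[OF assms]] .
  then obtain i where "i \<le> wlen w"
    "coef f (Word (take i (letters w))) * coef g (Word (drop i (letters w))) \<noteq> 0"
    unfolding coef_mult by (meson atMost_iff sum.neutral)
  then show "wdeg (f * g) \<le> wdeg f + wdeg g"
    using le_wdeg[of f "Word (take i (letters w))"] le_wdeg[of g "Word (drop i (letters w))"] w
    by auto
next
  obtain u where u: "wlen u = wdeg f" "coef f u \<noteq> 0" using wdeg_witness[OF assms(1)] .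
  obtain v where v: "wlen v = wdeg g" "coef g v \<noteq> 0" using wdeg_witness[OF assms(2)] .
  obtain r where "0 dvd r" "coef (f * g) (u + v) = r + coef f u * coef g v"
    using coef_mult_longest[of u 0 f v g] u v le_wdeg by (metis dvd_refl not_less)
  with u v have "coef (f * g) (u + v) \<noteq> 0" by simp
  from le_wdeg[OF this] show "wdeg f + wdeg g \<le> wdeg (f * g)" by (simp add: u v)
qed

section \<open>Greatest common left divisors in polynomials over the free algebra\<close>

text \<open>A transduction in the sense of Cohn: the words ending in \<open>v\<close> are kept, with
  this suffix deleted.\<close>

definition strip :: "'x word \<Rightarrow> ('x word \<Rightarrow>\<^sub>0 'r::zero) \<Rightarrow> 'x word \<Rightarrow>\<^sub>0 'r" where
  "strip v = Poly_Mapping.map_key (\<lambda>u. u + v)"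

lemma coef_strip: "coef (strip v f) u = coef f (u + v)"
proof -
  have "inj (\<lambda>u. u + v)" by (rule injI) simp
  from Poly_Mapping.map_key.rep_eq[OF this, of f] show ?thesis
    by (simp add: strip_def)
qed

text \<open>A cut inside \<open>v\<close> would leave a left factor longer than \<open>n\<close>,
  where \<open>f\<close> has no coefficient. So transduction commutes with left multiplication by
  \<open>f\<close> as far as long words are concerned.\<close>

lemma coef_mult_strip:
  fixes f g :: "'x word \<Rightarrow>\<^sub>0 'r::semiring_0"
  assumes "below (Suc n) f" "n \<le> wlen u"
  shows "coef (f * g) (u + v) = coef (f * strip v g) u"
proof -
  let ?h = "\<lambda>i. coef f (Word (take i (letters (u + v)))) * coef g (Word (drop i (letters (u + v))))"
  have "coef (f * g) (u + v) = sum ?h {..wlen (u + v)}"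
    by (rule coef_mult)
  also have "\<dots> = sum ?h {..wlen u}"
  proof (rule sum.mono_neutral_right)
    show "\<forall>i\<in>{..wlen (u + v)} - {..wlen u}. ?h i = 0"
    proof
      fix i assume "i \<in> {..wlen (u + v)} - {..wlen u}"
      then have "coef f (Word (take i (letters (u + v)))) = 0"
        using assms by (intro belowD[OF assms(1)]) auto
      then show "?h i = 0" by simp
    qed
  qed auto
  also have "\<dots> = coef (f * strip v g) u"
    unfolding coef_mult by (rule sum.cong) (auto simp: coef_strip plus_word_def)
  finally show ?thesis .
qed

text \<open>Cohn's weak algorithm for two elements. Transduction by a longest word of
  \<open>y\<close> turns \<open>y\<close> into a nonzero scalar \<open>s\<close> and
  \<open>x\<close> into \<open>q\<close>. As \<open>s\<close> need not be invertible in the domain,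
  \<open>Q\<close> is multiplied by it instead.\<close>

lemma weak_algorithm:
  fixes P Q x y :: "'x word \<Rightarrow>\<^sub>0 'r::idom"
  assumes "y \<noteq> 0" and le: "wdeg P \<le> wdeg Q"
    and small: "below (wdeg Q + wdeg y) (P * x - Q * y)"
  obtains s q where "s \<noteq> 0" "below (wdeg Q) (scalar s * Q - P * q)"
proof -
  obtain v where v: "wlen v = wdeg y" "coef y v \<noteq> 0"
    using wdeg_witness[OF \<open>y \<noteq> 0\<close>] .
  have "strip v y = scalar (coef y v)"
  proof (rule poly_mapping_eqI)
    fix u
    have "coef y (u + v) = 0" if "u \<noteq> 0"
      using that le_wdeg[of y "u + v"] v by auto
    then show "coef (strip v y) u = coef (scalar (coef y v)) u"
      by (simp add: coef_strip lookup_single when_def)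
  qed
  then have Q: "scalar (coef y v) * Q = Q * strip v y"
    by (simp add: scalar_central)
  have "below (wdeg Q) (scalar (coef y v) * Q - P * strip v x)"
    unfolding below_def
  proof (intro allI impI)
    fix u :: "'x word" assume u: "wdeg Q \<le> wlen u"
    have "coef (P * x - Q * y) (u + v) = 0"
      using belowD[OF small, of "u + v"] u v by simp
    moreover have "coef (P * x) (u + v) = coef (P * strip v x) u"
      using coef_mult_strip[OF below_wdeg] u le by (meson le_trans)
    moreover have "coef (Q * y) (u + v) = coef (Q * strip v y) u"
      using coef_mult_strip[OF below_wdeg] u by blast
    ultimately show "coef (scalar (coef y v) * Q - P * strip v x) u = 0"
      unfolding Q by (simp add: lookup_minus)
  qed
  with v(2) show thesis by (rule that)
qed

section \<open>Primitive elements and cancellation of scalars\<close>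

definition primitive :: "('x word \<Rightarrow>\<^sub>0 'r::algebraic_semidom) \<Rightarrow> bool" where
  "primitive e \<longleftrightarrow> (\<forall>c. (\<forall>w. c dvd coef e w) \<longrightarrow> is_unit c)"

lemma primitive_nonzero: "primitive e \<Longrightarrow> e \<noteq> 0"
  unfolding primitive_def by (metis dvd_0_left_iff lookup_zero not_is_unit_0)

lemma dvd_coef_imp_scalar_mult:
  fixes e :: "'x word \<Rightarrow>\<^sub>0 'r::idom_divide"
  assumes "\<And>w. c dvd coef e w"
  obtains e' where "e = scalar c * e'"
proof -
  have "coef e w = coef (scalar c * Poly_Mapping.map (\<lambda>x. x div c) e) w" for w
    using assms[of w] by (auto simp: Poly_Mapping.map.rep_eq when_def)
  then show thesis by (intro that) (rule poly_mapping_eqI)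
qed

lemma primitive_part:
  fixes e :: "'x word \<Rightarrow>\<^sub>0 'k::field poly"
  assumes "e \<noteq> 0"
  obtains c e' where "e = scalar c * e'" "primitive e'"
proof -
  obtain w where w: "coef e w \<noteq> 0"
    using assms by (metis lookup_zero poly_mapping_eqI)
  let ?D = "\<lambda>c. \<forall>w. c dvd coef e w"
  have bound: "degree c \<le> degree (coef e w)" if "?D c" for c
    using that w by (simp add: dvd_imp_degree_le)
  have "?D 1" by simp
  \<comment> \<open>The content of \<open>e\<close>, found as a common divisor of largest degree;
    the nonzero coefficient at \<open>w\<close> bounds the degrees.\<close>
  then obtain c where c: "?D c" and max: "\<And>c'. ?D c' \<Longrightarrow> degree c' \<le> degree c"
    using ex_has_greatest_nat[of ?D 1 degree "Suc (degree (coef e w))"] bound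
    by (metis less_Suc_eq_le)
  from c obtain e' where e': "e = scalar c * e'"
    using dvd_coef_imp_scalar_mult by blast
  have "c \<noteq> 0" using e' assms by auto
  have "primitive e'"
    unfolding primitive_def
  proof (intro allI impI)
    fix d assume d: "\<forall>w. d dvd coef e' w"
    then have "?D (c * d)" by (simp add: e' mult_dvd_mono)
    from max[OF this] have "degree (c * d) \<le> degree c" .
    moreover have "d \<noteq> 0"
      using d assms unfolding e' by (metis dvd_0_left_iff lookup_zero mult_zero_right poly_mapping_eqI)
    ultimately show "is_unit d"
      using \<open>c \<noteq> 0\<close> by (simp add: degree_mult_eq is_unit_iff_degree)
  qed
  with e' show thesis by (rule that)
qed

lemma ex_prime_elem_poly_dvd:
  fixes p :: "'k::field poly"
  assumes "degree p > 0"
  obtains \<pi> where "prime_elem \<pi>" "\<pi> dvd p"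
proof -
  let ?D = "\<lambda>c. c dvd p \<and> degree c > 0"
  obtain \<pi> where \<pi>: "?D \<pi>" and min: "\<And>c. ?D c \<Longrightarrow> degree \<pi> \<le> degree c"
    using ex_has_least_nat[of ?D p degree] assms by auto
  have "irreducible \<pi>"
  proof (rule irreducibleI)
    show "\<pi> \<noteq> 0" using \<pi> by auto
    then show "\<not> is_unit \<pi>" using \<pi> by (simp add: is_unit_iff_degree)
    fix a b assume ab: "\<pi> = a * b"
    with \<pi> have nz: "a \<noteq> 0" "b \<noteq> 0" by auto
    with ab have deg: "degree \<pi> = degree a + degree b" by (simp add: degree_mult_eq)
    have "a dvd p" using \<pi> ab by (metis dvd_mult_left)
    then have "degree a = 0 \<or> degree b = 0"
      using min[of a] deg by (cases "degree a = 0") auto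
    then show "is_unit a \<or> is_unit b" using nz by (simp add: is_unit_iff_degree)
  qed
  with \<pi> show thesis using that field_poly_irreducible_imp_prime by blast
qed

text \<open>Prime factors of \<open>p\<close> are removed one at a time: by Gauss's lemma each
  divides all coefficients of \<open>e\<close> or all of \<open>x\<close>, and primitivity excludes
  \<open>e\<close>. Thus left divisibility by \<open>e\<close> over k(t) already holds over
  k[t].\<close>

lemma primitive_cancel:
  fixes e b x :: "'x word \<Rightarrow>\<^sub>0 'k::field poly"
  assumes "primitive e" "p \<noteq> 0" "scalar p * b = e * x"
  shows "\<exists>y. b = e * y"
  using assms(2,3)
proof (induction "degree p" arbitrary: p x rule: less_induct)
  case less
  show ?case
  proof (cases "degree p = 0")
    case True
    then obtain q where "q * p = 1"
      using \<open>p \<noteq> 0\<close> by (metis dvdE is_unit_iff_degree mult.commute)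
    then have "b = scalar q * (scalar p * b)"
      by (simp add: scalar_mult_scalar flip: mult.assoc)
    also have "\<dots> = e * (scalar q * x)"
      by (simp add: less.prems(2) scalar_left_commute[of e])
    finally show ?thesis by blast
  next
    case False
    then obtain \<pi> where \<pi>: "prime_elem \<pi>" "\<pi> dvd p"
      using ex_prime_elem_poly_dvd[of p] by auto
    then have "\<pi> dvd coef (e * x) w" for w
      by (simp flip: less.prems(2))
    then have "(\<forall>w. \<pi> dvd coef e w) \<or> (\<forall>w. \<pi> dvd coef x w)"
      using prime_dvd_coef_mult[of \<pi> e x] \<pi>(1) by (simp add: prime_elem_dvd_mult_iff)
    moreover have "\<not> is_unit \<pi>" using \<pi>(1) by (rule prime_elem_not_unit)
    ultimately have "\<forall>w. \<pi> dvd coef x w"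
      using \<open>primitive e\<close> by (auto simp: primitive_def)
    then obtain x' where x': "x = scalar \<pi> * x'"
      using dvd_coef_imp_scalar_mult by blast
    from \<pi>(2) obtain p' where p': "p = \<pi> * p'" by blast
    have nz: "\<pi> \<noteq> 0" "p' \<noteq> 0" using \<open>p \<noteq> 0\<close> p' by auto
    have "scalar \<pi> * (scalar p' * b) = scalar \<pi> * (e * x')"
      using less.prems(2)
      by (simp add: p' x' scalar_left_commute[of e] mult.assoc flip: scalar_mult_scalar)
    then have "scalar p' * b = e * x'"
      using nz by (simp add: free_mult_left_cancel)
    moreover have "degree p' < degree p"
      using nz \<open>\<not> is_unit \<pi>\<close> by (simp add: p' degree_mult_eq is_unit_iff_degree)
    ultimately show ?thesis using less.hyps nz(2) by blast
  qed
qed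

text \<open>Over k(t) the element \<open>e\<close> generates the right ideal of \<open>a\<close> and
  \<open>b\<close>; \<open>p\<close> is a common denominator in the Bezout identity.\<close>

definition has_gcd :: "('x word \<Rightarrow>\<^sub>0 'k::field poly) \<Rightarrow> ('x word \<Rightarrow>\<^sub>0 'k poly) \<Rightarrow> bool" where
  "has_gcd a b \<longleftrightarrow> (\<exists>e p u v a' b'. primitive e \<and> p \<noteq> 0 \<and> scalar p * e = a * u + b * v \<and>
    a = e * a' \<and> b = e * b')"

lemma has_gcd_commute: "has_gcd a b \<Longrightarrow> has_gcd b a"
  unfolding has_gcd_def by (metis add.commute)

text \<open>Euclid's algorithm, with the common right multiple as the dependence that
  \<open>weak_algorithm\<close> requires. Replacing the element of no smaller degree by its
  remainder lowers the sum of the degrees; when the remainder is zero, the primitive part of the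
  other element is the divisor sought.\<close>

lemma common_multiple_imp_has_gcd:
  fixes a b x y :: "'x word \<Rightarrow>\<^sub>0 'k::field poly"
  assumes "a * x = b * y" "a * x \<noteq> 0"
  shows "has_gcd a b"
  using assms
proof (induction "wdeg a + wdeg b" arbitrary: a b x y rule: less_induct)
  case less
  have step: "has_gcd a b" if IH: "\<And>(a' :: 'x word \<Rightarrow>\<^sub>0 'k poly) b' x y. wdeg a' + wdeg b' < wdeg a + wdeg b \<Longrightarrow>
        a' * x = b' * y \<Longrightarrow> a' * x \<noteq> 0 \<Longrightarrow> has_gcd a' b'"
      and le: "wdeg a \<le> wdeg b" and eq: "a * x = b * y" "a * x \<noteq> 0"
    for a b x y :: "'x word \<Rightarrow>\<^sub>0 'k poly"
  proof -
    have nz: "a \<noteq> 0" "b \<noteq> 0" "y \<noteq> 0" using eq by (auto simp: free_mult_eq_0_iff)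
    obtain s q where s: "s \<noteq> 0" and lower: "below (wdeg b) (scalar s * b - a * q)"
      using weak_algorithm[OF nz(3) le, of x] eq(1) by auto
    define b' where "b' = scalar s * b - a * q"
    show ?thesis
    proof (cases "b' = 0")
      case True
      obtain c e where e: "a = scalar c * e" "primitive e"
        using primitive_part[OF nz(1)] .
      have "scalar s * b = e * (scalar c * q)"
        using True by (simp add: b'_def e(1) scalar_left_commute[of e] mult.assoc)
      then obtain z where "b = e * z" using primitive_cancel[OF e(2) s] by blast
      moreover have "a = e * scalar c" by (simp add: e(1) scalar_central)
      moreover have "scalar c * e = a * 1 + b * 0" by (simp add: e(1))
      moreover have "c \<noteq> 0" using e(1) nz(1) by auto
      ultimately show ?thesis unfolding has_gcd_def using e(2) by blast
    next
      case False
      with lower have "wdeg b' < wdeg b"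
        using below_iff_wdeg_less b'_def by blast
      \<comment> \<open>The remainder again has a common right multiple with \<open>a\<close>,
        because \<open>b * y = a * x\<close>.\<close>
      moreover have "a * (scalar s * x - q * y) = b' * y"
        by (simp add: b'_def algebra_simps scalar_left_commute[of a] eq(1))
      moreover have "b' * y \<noteq> 0" using False nz(3) by (simp add: free_mult_eq_0_iff)
      ultimately have "has_gcd a b'" using IH[of a b'] by simp
      then obtain e p u v a1 b1 where e: "primitive e" "p \<noteq> 0" "scalar p * e = a * u + b' * v"
        "a = e * a1" "b' = e * b1"
        unfolding has_gcd_def by blast
      have "scalar s * b = a * q + b'" by (simp add: b'_def)
      also have "\<dots> = e * (a1 * q + b1)" by (simp add: e(4,5) distrib_left mult.assoc)
      finally obtain z where "b = e * z" using primitive_cancel[OF e(1) s] by blast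
      moreover have "scalar p * e = a * (u - q * v) + b * (scalar s * v)"
        by (simp add: e(3) b'_def algebra_simps scalar_left_commute[of a] scalar_left_commute[of b])
      ultimately show ?thesis unfolding has_gcd_def using e by blast
    qed
  qed
  show ?case
  proof (cases "wdeg a \<le> wdeg b")
    case True
    show ?thesis by (rule step[OF less.hyps True less.prems])
  next
    case False
    have "has_gcd b a"
    proof (rule step)
      show "wdeg b \<le> wdeg a" "b * y = a * x" "b * y \<noteq> 0" using False less.prems by auto
      fix a' b' x y :: "'x word \<Rightarrow>\<^sub>0 'k poly"
      assume "wdeg a' + wdeg b' < wdeg b + wdeg a" "a' * x = b' * y" "a' * x \<noteq> 0"
      then show "has_gcd a' b'" using less.hyps[of a' b' x y] by simp
    qed
    then show ?thesis by (rule has_gcd_commute)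
  qed
qed

section \<open>The face homomorphism\<close>

definition supported :: "'x word set \<Rightarrow> ('x word \<Rightarrow>\<^sub>0 'r::zero) set" where
  "supported M = {f. Poly_Mapping.keys f \<subseteq> M}"

lemma supportedI: "(\<And>w. coef f w \<noteq> 0 \<Longrightarrow> w \<in> M) \<Longrightarrow> f \<in> supported M"
  by (auto simp: supported_def in_keys_iff)

lemma supportedD: "f \<in> supported M \<Longrightarrow> coef f w \<noteq> 0 \<Longrightarrow> w \<in> M"
  by (auto simp: supported_def in_keys_iff)

lemma supported_diff: "f \<in> supported M \<Longrightarrow> g \<in> supported M \<Longrightarrow> f - g \<in> supported M"
  for f g :: "'x word \<Rightarrow>\<^sub>0 'r::ab_group_add"
  by (rule supportedI) (metis diff_0_right lookup_minus supportedD)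

lemma supported_scalar_mult: "f \<in> supported M \<Longrightarrow> scalar c * f \<in> supported M"
  for f :: "'x word \<Rightarrow>\<^sub>0 'r::semiring_0"
  by (rule supportedI) (metis coef_scalar_mult mult_zero_right supportedD)

section \<open>Extension of scalars from k to k[t]\<close>

definition const_poly :: "('x word \<Rightarrow>\<^sub>0 'k::field) \<Rightarrow> 'x word \<Rightarrow>\<^sub>0 'k poly" where
  "const_poly f = Poly_Mapping.map (\<lambda>c. [:c:]) f"

lemma coef_const_poly [simp]: "coef (const_poly f) w = [:coef f w:]"
  by (simp add: const_poly_def Poly_Mapping.map.rep_eq when_def)

lemma const_poly_add: "const_poly (f + g) = const_poly f + const_poly g"
  by (rule poly_mapping_eqI) (simp add: lookup_add)

lemma const_poly_diff: "const_poly (f - g) = const_poly f - const_poly g"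
  by (rule poly_mapping_eqI) (simp add: lookup_minus)

lemma const_poly_mult: "const_poly (f * g) = const_poly f * const_poly g"
  by (rule poly_mapping_eqI) (simp add: coef_mult monom_sum flip: monom_0, simp add: mult_monom)

lemma const_poly_scalar: "const_poly (scalar c) = scalar [:c:]"
  by (rule poly_mapping_eqI) (simp add: lookup_single when_def)

lemma const_poly_eq_0_iff [simp]: "const_poly f = 0 \<longleftrightarrow> f = 0"
proof
  assume "const_poly f = 0"
  then have "[:coef f w:] = 0" for w by (metis coef_const_poly lookup_zero)
  then show "f = 0" by (intro poly_mapping_eqI) simp
qed (rule poly_mapping_eqI, simp)

lemma supported_const_poly: "f \<in> supported M \<Longrightarrow> const_poly f \<in> supported M"
  by (rule supportedI) (auto dest: supportedD)

text \<open>By \<open>plus_mem_F_iff\<close>, discarding the words outside \<open>F\<close> is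
  multiplicative on elements supported in \<open>M\<close>. By \<open>F_unique\<close>, length tells
  the words of \<open>F\<close> apart, so a power of t can stand for a word.\<close>

locale word_face =
  fixes M F :: "'x word set"
  assumes zero_mem: "0 \<in> F"
    and F_subset: "F \<subseteq> M"
    and plus_mem: "u \<in> M \<Longrightarrow> v \<in> M \<Longrightarrow> u + v \<in> M"
    and plus_mem_F_iff: "u \<in> M \<Longrightarrow> v \<in> M \<Longrightarrow> u + v \<in> F \<longleftrightarrow> u \<in> F \<and> v \<in> F"
    and F_unique: "u \<in> F \<Longrightarrow> v \<in> F \<Longrightarrow> wlen u = wlen v \<Longrightarrow> u = v"
begin

text \<open>The t that records length is the same t that occurs in the coefficients. This
  identification makes \<open>face_poly\<close> kill
  \<open>const_poly f - scalar (face f)\<close>.\<close>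

definition face_poly :: "('x word \<Rightarrow>\<^sub>0 'k::field poly) \<Rightarrow> 'k poly" where
  "face_poly r = (\<Sum>w\<in>Poly_Mapping.keys r. if w \<in> F then coef r w * monom 1 (wlen w) else 0)"

definition face :: "('x word \<Rightarrow>\<^sub>0 'k::field) \<Rightarrow> 'k poly" where
  "face f = face_poly (const_poly f)"

lemma face_poly_superset:
  assumes "finite S" "Poly_Mapping.keys f \<subseteq> S"
  shows "face_poly f = (\<Sum>w\<in>S. if w \<in> F then coef f w * monom 1 (wlen w) else 0)"
  unfolding face_poly_def using assms by (intro sum.mono_neutral_left) (auto simp: in_keys_iff)

lemma face_poly_add: "face_poly (f + g) = face_poly f + face_poly g"
proof -
  let ?S = "Poly_Mapping.keys f \<union> Poly_Mapping.keys g"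
  let ?h = "\<lambda>f w. if w \<in> F then coef f w * monom 1 (wlen w) else 0"
  have "face_poly (f + g) = sum (?h (f + g)) ?S"
    by (rule face_poly_superset) (use Poly_Mapping.keys_add[of f g] in auto)
  also have "\<dots> = (\<Sum>w\<in>?S. ?h f w + ?h g w)"
    by (rule sum.cong) (auto simp: lookup_add distrib_right)
  also have "\<dots> = face_poly f + face_poly g"
    by (simp add: sum.distrib face_poly_superset[of ?S f] face_poly_superset[of ?S g])
  finally show ?thesis .
qed

lemma face_poly_zero [simp]: "face_poly 0 = 0"
  by (simp add: face_poly_def)

lemma face_poly_sum: "face_poly (sum h A) = (\<Sum>x\<in>A. face_poly (h x))"
  by (induction A rule: infinite_finite_induct) (simp_all add: face_poly_add)

lemma face_poly_diff: "face_poly (f - g) = face_poly f - face_poly g"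
  using face_poly_add[of "f - g" g] by simp

lemma face_poly_single:
  "face_poly (Poly_Mapping.single w c) = (if w \<in> F then c * monom 1 (wlen w) else 0)"
  by (simp add: face_poly_def)

lemma face_poly_scalar [simp]: "face_poly (scalar c) = c"
  by (simp add: face_poly_single zero_mem monom_0 flip: one_pCons)

lemma face_poly_mult:
  fixes f g :: "'x word \<Rightarrow>\<^sub>0 'k::field poly"
  assumes "f \<in> supported M" "g \<in> supported M"
  shows "face_poly (f * g) = face_poly f * face_poly g"
proof -
  let ?s = "\<lambda>h w. Poly_Mapping.single w (coef h w)"
  have expand: "(\<Sum>w\<in>Poly_Mapping.keys h. ?s h w) = h" for h :: "'x word \<Rightarrow>\<^sub>0 'k poly"
    by (rule poly_mapping_eqI) (simp add: lookup_sum lookup_single when_def in_keys_iff)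
  have "(\<Sum>u\<in>Poly_Mapping.keys f. ?s f u) * (\<Sum>v\<in>Poly_Mapping.keys g. ?s g v) =
      (\<Sum>u\<in>Poly_Mapping.keys f. \<Sum>v\<in>Poly_Mapping.keys g. ?s f u * ?s g v)"
    by (rule sum_product)
  then have "face_poly (f * g) =
      (\<Sum>u\<in>Poly_Mapping.keys f. \<Sum>v\<in>Poly_Mapping.keys g. face_poly (?s f u * ?s g v))"
    by (simp add: face_poly_sum expand)
  also have "\<dots> = (\<Sum>u\<in>Poly_Mapping.keys f. \<Sum>v\<in>Poly_Mapping.keys g.
      face_poly (?s f u) * face_poly (?s g v))"
  proof (intro sum.cong refl)
    fix u v assume "u \<in> Poly_Mapping.keys f" "v \<in> Poly_Mapping.keys g"
    with assms have "u + v \<in> F \<longleftrightarrow> u \<in> F \<and> v \<in> F"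
      by (intro plus_mem_F_iff) (auto simp: supported_def)
    moreover have "monom 1 (wlen u + wlen v) = monom 1 (wlen u) * (monom 1 (wlen v) :: 'k poly)"
      by (simp add: mult_monom)
    ultimately show "face_poly (?s f u * ?s g v) = face_poly (?s f u) * face_poly (?s g v)"
      by (simp add: mult_single face_poly_single)
  qed
  also have "\<dots> = face_poly (\<Sum>u\<in>Poly_Mapping.keys f. ?s f u) *
      face_poly (\<Sum>v\<in>Poly_Mapping.keys g. ?s g v)"
    by (simp only: face_poly_sum sum_product)
  finally show ?thesis by (simp only: expand)
qed

lemma face_zero [simp]: "face 0 = 0"
  by (simp add: face_def iffD2[OF const_poly_eq_0_iff])

lemma face_diff: "face (f - g) = face f - face g"
  by (simp add: face_def const_poly_diff face_poly_diff)

lemma face_scalar [simp]: "face (scalar c) = [:c:]"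
  by (simp add: face_def const_poly_scalar)

lemma face_one [simp]: "face 1 = 1"
  using face_scalar[of 1] by (simp add: one_pCons)

lemma face_mult:
  "f \<in> supported M \<Longrightarrow> g \<in> supported M \<Longrightarrow> face (f * g) = face f * face g"
  by (simp add: face_def const_poly_mult face_poly_mult supported_const_poly)

lemma supported_mult:
  fixes f g :: "'x word \<Rightarrow>\<^sub>0 'r::semiring_0"
  shows "f \<in> supported M \<Longrightarrow> g \<in> supported M \<Longrightarrow> f * g \<in> supported M"
  unfolding supported_def using keys_mult[of f g] plus_mem by fastforce

lemma supported_scalar: "scalar c \<in> supported M"
  using zero_mem F_subset by (auto simp: supported_def)

lemma supported_power: "f \<in> supported M \<Longrightarrow> f ^ n \<in> supported M"
  for f :: "'x word \<Rightarrow>\<^sub>0 'r::comm_semiring_1"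
  by (induction n) (auto intro: supported_mult supported_scalar simp flip: single_one)

lemma face_power: "f \<in> supported M \<Longrightarrow> face (f ^ n) = face f ^ n"
  by (induction n) (simp_all add: face_mult supported_power)

lemma face_scalar_mult:
  fixes f :: "'x word \<Rightarrow>\<^sub>0 'k::field"
  shows "face (scalar c * f) = smult c (face f)"
proof -
  have "face_poly (scalar p * r) = p * face_poly r" for p and r :: "'x word \<Rightarrow>\<^sub>0 'k poly"
    by (subst face_poly_superset[of "Poly_Mapping.keys r"])
      (auto simp: face_poly_def in_keys_iff sum_distrib_left mult.assoc intro!: sum.cong)
  then show ?thesis by (simp add: face_def const_poly_mult const_poly_scalar)
qed

text \<open>No other word of \<open>F\<close> has the length of \<open>w\<close>, so nothing else
  contributes to this power of t.\<close>

lemma coeff_face: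
  assumes "w \<in> F"
  shows "coeff (face f) (wlen w) = coef f w"
proof -
  have "Poly_Mapping.keys (const_poly f) \<subseteq> Poly_Mapping.keys f"
    by (auto simp: in_keys_iff)
  from face_poly_superset[OF finite_keys this]
  have "coeff (face f) (wlen w) = (\<Sum>u\<in>Poly_Mapping.keys f.
      coeff (if u \<in> F then [:coef f u:] * monom 1 (wlen u) else 0) (wlen w))"
    by (simp add: face_def coeff_sum cong: if_cong)
  also have "\<dots> = (\<Sum>u\<in>Poly_Mapping.keys f. if u = w then coef f w else 0)"
    using assms by (intro sum.cong refl) (auto dest: F_unique)
  also have "\<dots> = coef f w" by (simp add: in_keys_iff)
  finally show ?thesis .
qed

lemma degree_face_pos:
  assumes "w \<in> F" "w \<noteq> 0" "coef f w \<noteq> 0"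
  shows "degree (face f) > 0"
proof -
  have "wlen w \<le> degree (face f)"
    using assms coeff_face[of w f] by (intro le_degree) simp
  then show ?thesis using assms(2) by (metis gr0I le_zero_eq length_0_conv letters_eq_Nil_iff)
qed

end

section \<open>Words as digit strings and the choice of a face\<close>

fun digits_value :: "nat \<Rightarrow> ('x \<Rightarrow> nat) \<Rightarrow> 'x list \<Rightarrow> nat" where
  "digits_value b d [] = 0"
| "digits_value b d (x # xs) = d x * b ^ length xs + digits_value b d xs"

lemma digits_value_append:
  "digits_value b d (xs @ ys) = digits_value b d xs * b ^ length ys + digits_value b d ys"
  by (induction xs) (simp_all add: algebra_simps power_add)

lemma digits_value_less: "(\<And>x. d x < b) \<Longrightarrow> digits_value b d xs < b ^ length xs"
proof (induction xs)
  case (Cons x xs)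
  then have "Suc (d x) * b ^ length xs \<le> b * b ^ length xs"
    by (intro mult_right_mono) (simp_all add: Suc_leI)
  with Cons show ?case by simp
qed simp

lemma digits_value_inj:
  assumes "inj d" "\<And>x. d x < b"
  shows "length xs = length ys \<Longrightarrow> digits_value b d xs = digits_value b d ys \<Longrightarrow> xs = ys"
proof (induction rule: list_induct2)
  case (Cons x xs y ys)
  have less: "digits_value b d zs < b ^ length zs" for zs
    by (rule digits_value_less) (rule assms)
  let ?m = "b ^ length ys"
  have m: "?m \<noteq> 0" using less[of ys] by (metis not_less_zero)
  have "d x = (d x * ?m + digits_value b d xs) div ?m"
    using less[of xs] Cons.hyps by (simp add: div_mult_self3[OF m])
  also have "\<dots> = (d y * ?m + digits_value b d ys) div ?m"
    using Cons.prems Cons.hyps by simp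
  also have "\<dots> = d y" using less[of ys] by (simp add: div_mult_self3[OF m])
  finally have "x = y" using assms(1) by (simp add: inj_eq)
  with Cons show ?case by simp
qed simp

lemma ex_word_face:
  fixes U :: "'x::finite word set"
  assumes "finite U" "U - {0} \<noteq> {}"
  obtains M F where "word_face M F" "U \<subseteq> M" "\<exists>w\<in>U. w \<in> F \<and> w \<noteq> 0"
proof -
  obtain d :: "'x \<Rightarrow> nat" where d: "bij_betw d UNIV {0..<card (UNIV :: 'x set)}"
    using ex_bij_betw_finite_nat[of "UNIV :: 'x set"] by auto
  \<comment> \<open>One more than the number of letters, so that \<open>b > 1\<close> even for a
    single letter and the denominators below are positive for nonempty words.\<close>
  define b where "b = card (UNIV :: 'x set) + 1"
  have "inj d" using d by (simp add: bij_betw_def)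
  have db: "d x < b" for x
    using bij_betwE[OF d] unfolding b_def
    by (metis UNIV_I atLeastLessThan_iff less_SucI Suc_eq_plus1)
  have "b > 1" by (simp add: b_def finite_UNIV_card_ge_0)
  define \<nu> where "\<nu> w = digits_value b d (letters w)" for w
  define \<rho> where "\<rho> w = real (\<nu> w) / (real b ^ wlen w - 1)" for w
  obtain m where m: "m \<in> U - {0}" "\<And>w. w \<in> U - {0} \<Longrightarrow> \<rho> w \<le> \<rho> m"
  proof -
    have "Max (\<rho> ` (U - {0})) \<in> \<rho> ` (U - {0})" using assms by (intro Max_in) auto
    then obtain m where m: "m \<in> U - {0}" "\<rho> m = Max (\<rho> ` (U - {0}))" by (metis imageE)
    have "\<rho> w \<le> \<rho> m" if "w \<in> U - {0}" for w
      using Max_ge[of "\<rho> ` (U - {0})" "\<rho> w"] that assms(1) m(2) by simp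
    with m(1) show thesis by (rule that)
  qed
  \<comment> \<open>On nonempty words \<delta> has the sign of \<open>\<rho> w - \<rho> m\<close>,
    and it is 0 on the empty word. The cocycle identity \<open>\<delta>_plus\<close> has positive
    weights, so \<open>\<delta> \<le> 0\<close> is closed under concatenation and a product has
    value 0 only if both factors do.\<close>
  define \<delta> where "\<delta> w = real (\<nu> w) - \<rho> m * (real b ^ wlen w - 1)" for w
  have \<delta>_plus: "\<delta> (u + v) = real b ^ wlen v * \<delta> u + \<delta> v" for u v
    by (simp add: \<delta>_def \<nu>_def plus_word_def digits_value_append power_add algebra_simps)
  have \<delta>_0: "\<delta> 0 = 0" by (simp add: \<delta>_def \<nu>_def zero_word_def)
  have pos: "real b ^ wlen w - 1 > 0" if "w \<noteq> 0" for w :: "'x word"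
  proof -
    have "wlen w > 0" using that by simp
    with \<open>b > 1\<close> show ?thesis by simp
  qed
  have \<delta>_U: "\<delta> w \<le> 0" if "w \<in> U" for w
  proof (cases "w = 0")
    case False
    with m(2)[of w] that have "\<rho> w \<le> \<rho> m" by simp
    then show ?thesis using pos[OF False] by (simp add: \<rho>_def[of w] \<delta>_def pos_divide_le_eq)
  qed (simp add: \<delta>_0)
  have \<delta>_m: "\<delta> m = 0" using pos[of m] m(1) by (simp add: \<delta>_def \<rho>_def[of m])
  have bpos: "real b ^ n > 0" for n using \<open>b > 1\<close> by simp
  have "word_face {w. \<delta> w \<le> 0} {w. \<delta> w = 0}"
  proof
    fix u v :: "'x word"
    {
      assume uv: "u \<in> {w. \<delta> w \<le> 0}" "v \<in> {w. \<delta> w \<le> 0}"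
      then have le: "real b ^ wlen v * \<delta> u \<le> 0"
        using bpos[of "wlen v"] by (simp add: mult_nonneg_nonpos)
      then show "u + v \<in> {w. \<delta> w \<le> 0}" using uv by (simp add: \<delta>_plus)
      have "real b ^ wlen v * \<delta> u + \<delta> v = 0 \<longleftrightarrow> real b ^ wlen v * \<delta> u = 0 \<and> \<delta> v = 0"
        using le uv by (auto simp del: mult_eq_0_iff)
      then show "u + v \<in> {w. \<delta> w = 0} \<longleftrightarrow> u \<in> {w. \<delta> w = 0} \<and> v \<in> {w. \<delta> w = 0}"
        using \<open>b > 1\<close> by (simp add: \<delta>_plus)
    next
      assume "u \<in> {w. \<delta> w = 0}" "v \<in> {w. \<delta> w = 0}" and len: "wlen u = wlen v"
      \<comment> \<open>At a fixed length, \<delta> = 0 determines the digit value and hence the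
        word.\<close>
      then have "\<nu> u = \<nu> v" by (simp add: \<delta>_def)
      with len show "u = v"
        using digits_value_inj[OF \<open>inj d\<close> db, of "letters u" "letters v"]
        by (simp add: \<nu>_def word.expand)
    }
  qed (auto simp: \<delta>_0)
  then show thesis
    by (rule that) (use \<delta>_U \<delta>_m m(1) in auto)
qed

section \<open>Centralizers are commutative\<close>

definition centralizer :: "'a::ring_1 \<Rightarrow> 'a set" where
  "centralizer f = {h. h * f = f * h}"

lemma centralizerD: "h \<in> centralizer f \<Longrightarrow> h * f = f * h"
  by (simp add: centralizer_def)

lemma centralizer_self: "f \<in> centralizer f"
  by (simp add: centralizer_def)

lemma centralizer_diff: "g \<in> centralizer f \<Longrightarrow> h \<in> centralizer f \<Longrightarrow> g - h \<in> centralizer f"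
  by (simp add: centralizer_def algebra_simps)

lemma centralizer_add: "g \<in> centralizer f \<Longrightarrow> h \<in> centralizer f \<Longrightarrow> g + h \<in> centralizer f"
  by (simp add: centralizer_def algebra_simps)

lemma centralizer_mult:
  assumes "g \<in> centralizer f" "h \<in> centralizer f"
  shows "g * h \<in> centralizer f"
proof -
  have "g * h * f = g * f * h"
    using centralizerD[OF assms(2)] by (simp add: mult.assoc)
  then show ?thesis
    using centralizerD[OF assms(1)] by (simp add: centralizer_def mult.assoc)
qed

lemma centralizer_scalar: "scalar c \<in> centralizer f" for c :: "'r::comm_ring_1"
  by (simp add: centralizer_def scalar_central)

lemma centralizer_zero: "0 \<in> centralizer f"
  by (simp add: centralizer_def)

lemma centralizer_one: "1 \<in> centralizer f"
  by (simp add: centralizer_def)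

lemma centralizer_power: "g \<in> centralizer f \<Longrightarrow> g ^ n \<in> centralizer f"
  by (induction n) (auto intro: centralizer_mult centralizer_one)

section \<open>Leading terms in a centralizer\<close>

lemma wdeg_scalar_mult: "c \<noteq> 0 \<Longrightarrow> wdeg (scalar c * f) = wdeg f"
  for f :: "'x word \<Rightarrow>\<^sub>0 'r::idom"
  by (cases "f = 0") (simp_all add: wdeg_mult)

lemma free_power_nonzero: "f \<noteq> 0 \<Longrightarrow> f ^ n \<noteq> 0" for f :: "'x word \<Rightarrow>\<^sub>0 'r::idom"
  by (induction n) (simp_all add: free_mult_eq_0_iff)

lemma wdeg_power: "f \<noteq> 0 \<Longrightarrow> wdeg (f ^ n) = n * wdeg f" for f :: "'x word \<Rightarrow>\<^sub>0 'r::idom"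
  by (induction n) (simp_all add: wdeg_mult free_power_nonzero flip: single_one)

text \<open>A high power \<open>G\<close> of \<open>f\<close> commutes with \<open>g\<close> and
  \<open>h\<close>, so by the weak algorithm it is, up to a scalar and lower degree, a right
  multiple of each. This relates \<open>g\<close> to \<open>h\<close>, and a further use of the weak
  algorithm gives \<open>h\<close> as \<open>g * z\<close> up to a scalar and lower degree, where
  \<open>z\<close> has degree 0.\<close>

lemma centralizer_proportional:
  fixes f g h :: "'x word \<Rightarrow>\<^sub>0 'k::field"
  assumes f: "wdeg f > 0" and gh: "g \<in> centralizer f" "h \<in> centralizer f"
    and "g \<noteq> 0" "wdeg h = wdeg g"
  obtains c where "below (wdeg g) (h - scalar c * g)"
proof (cases "h = 0")
  case True
  then show thesis using that[of 0] by simp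
next
  case False
  have "f \<noteq> 0" using f by auto
  \<comment> \<open>This exponent is large enough: \<open>f\<close> has degree at least 1, so
    \<open>G\<close> has degree at least that of \<open>g\<close>.\<close>
  define G where "G = f ^ wdeg g"
  have G: "G \<noteq> 0" "wdeg g \<le> wdeg G"
    using f \<open>f \<noteq> 0\<close> by (simp_all add: G_def wdeg_power free_power_nonzero)
  have comm: "k * G = G * k" if "k \<in> centralizer f" for k
    using that power_commuting_commutes[of f k] by (simp add: G_def centralizer_def)
  obtain s q where s: "s \<noteq> 0" "below (wdeg G) (scalar s * G - g * q)"
    using weak_algorithm[OF \<open>g \<noteq> 0\<close> G(2), of G] comm[OF gh(1)] by auto
  obtain t r where t: "t \<noteq> 0" "below (wdeg G) (scalar t * G - h * r)"
    using weak_algorithm[OF False, of h G G] comm[OF gh(2)] G(2) assms(5) by auto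
  have "scalar t * G \<noteq> 0" "wdeg (scalar t * G) = wdeg G"
    using G(1) t(1) by (simp_all add: free_mult_eq_0_iff wdeg_scalar_mult)
  with wdeg_diff_less[of "scalar t * G" "h * r"] t(2)
  have "h * r \<noteq> 0" "wdeg (h * r) = wdeg G" by simp_all
  then have r: "r \<noteq> 0" "wdeg G = wdeg h + wdeg r" by (auto simp: wdeg_mult free_mult_eq_0_iff)
  have "g * (scalar t * q) - h * (scalar s * r) =
      scalar s * (scalar t * G - h * r) - scalar t * (scalar s * G - g * q)"
    by (simp add: right_diff_distrib scalar_left_commute[of g] scalar_left_commute[of h]
        scalar_left_commute[of "scalar s"])
  with s(2) t(2) have "below (wdeg G) (g * (scalar t * q) - h * (scalar s * r))"
    by (simp add: below_diff below_scalar_mult)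
  then have "below (wdeg h + wdeg (scalar s * r)) (g * (scalar t * q) - h * (scalar s * r))"
    using s(1) r(2) by (simp add: wdeg_scalar_mult)
  then obtain a z where a: "a \<noteq> 0" "below (wdeg h) (scalar a * h - g * z)"
    using weak_algorithm[of "scalar s * r" g h "scalar t * q"] s(1) r(1) assms(5)
    by (auto simp: free_mult_eq_0_iff)
  have "scalar a * h \<noteq> 0" "wdeg (scalar a * h) = wdeg h"
    using False a(1) by (simp_all add: free_mult_eq_0_iff wdeg_scalar_mult)
  with wdeg_diff_less[of "scalar a * h" "g * z"] a(2)
  have "g * z \<noteq> 0" "wdeg (g * z) = wdeg h" by simp_all
  then have "wdeg z = 0" using assms(5) by (auto simp: wdeg_mult free_mult_eq_0_iff)
  then obtain c where c: "z = scalar c" using wdeg_0_imp_scalar by blast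
  have "h - scalar (c / a) * g = scalar (1 / a) * (scalar a * h - g * z)"
    using a(1) by (intro poly_mapping_eqI) (simp add: c lookup_minus field_simps)
  with a(2) assms(5) show thesis by (intro that[of "c / a"]) (simp add: below_scalar_mult)
qed

context word_face
begin

text \<open>Choose an element \<open>b r\<close> of least degree in each class of degrees modulo
  \<open>wdeg q\<close>. By proportionality every \<open>h\<close> is, up to lower degree, a scalar
  multiple of some \<open>q ^ j * b r\<close>, and this has face 0 unless \<open>j = 0\<close>. So
  finitely many faces bound all degrees.\<close>

lemma degree_face_bounded:
  fixes q :: "'x word \<Rightarrow>\<^sub>0 'k::field"
  assumes f: "wdeg f > 0" and q: "q \<in> centralizer f" "q \<in> supported M" "face q = 0" "q \<noteq> 0"
  obtains N where "\<And>h. h \<in> centralizer f \<Longrightarrow> h \<in> supported M \<Longrightarrow> degree (face h) \<le> N"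
proof -
  let ?C = "centralizer f \<inter> supported M"
  have "wdeg q \<noteq> 0"
  proof
    assume "wdeg q = 0"
    then obtain c where c: "q = scalar c" using wdeg_0_imp_scalar by blast
    with q show False by simp
  qed
  define s where "s = wdeg q"
  have "s > 0" using \<open>wdeg q \<noteq> 0\<close> by (simp add: s_def)
  let ?P = "\<lambda>r b. b \<in> ?C \<and> b \<noteq> 0 \<and> wdeg b mod s = r"
  have "\<exists>b. \<forall>h. ?P r h \<longrightarrow> ?P r b \<and> wdeg b \<le> wdeg h" for r
    using ex_has_least_nat[of "?P r" _ wdeg] by blast
  then obtain b where b: "\<And>r h. ?P r h \<Longrightarrow> ?P r (b r) \<and> wdeg (b r) \<le> wdeg h" by metis
  \<comment> \<open>The sum dominates each of its terms; \<open>b r\<close> is an arbitrary element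
    when its residue class is empty.\<close>
  define N where "N = (\<Sum>r<s. degree (face (b r)))"
  have "degree (face h) \<le> N" if "h \<in> ?C" for h
    using that
  proof (induction "wdeg h" arbitrary: h rule: less_induct)
    case less
    show ?case
    proof (cases "h = 0")
      case False
      define r where "r = wdeg h mod s"
      have br: "?P r (b r)" "wdeg (b r) \<le> wdeg h"
        using b[of h r] False less.prems by (auto simp: r_def)
      then obtain j where j: "wdeg h = wdeg (b r) + s * j"
        using mod_eq_nat1E[of "wdeg h" s "wdeg (b r)"] by (auto simp: r_def)
      define g where "g = q ^ j * b r"
      have g: "g \<in> ?C" "g \<noteq> 0" "wdeg g = wdeg h"
        using br q unfolding g_def s_def
        by (auto intro: centralizer_mult centralizer_power supported_mult supported_power
            simp: free_mult_eq_0_iff free_power_nonzero wdeg_mult wdeg_power j s_def)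
      then obtain c where c: "below (wdeg h) (h - scalar c * g)"
        using centralizer_proportional[OF f, of g h] less.prems by auto
      define d where "d = h - scalar c * g"
      have dC: "d \<in> ?C"
        using g less.prems unfolding d_def
        by (auto intro: centralizer_diff centralizer_mult centralizer_scalar supported_diff
            supported_scalar_mult)
      have "degree (face d) \<le> N"
      proof (cases "d = 0")
        case False
        with c have "wdeg d < wdeg h" using below_iff_wdeg_less d_def by blast
        with less.hyps dC show ?thesis by blast
      qed simp
      moreover have "degree (face g) \<le> N"
      proof (cases "j = 0")
        case True
        have "degree (face (b r)) \<le> N"
          unfolding N_def using \<open>s > 0\<close> by (intro member_le_sum) (auto simp: r_def)
        with True show ?thesis by (simp add: g_def)
      next
        case False
        have "face g = face q ^ j * face (b r)"
          using q br unfolding g_def by (simp add: face_mult face_power supported_power)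
        with False q(3) show ?thesis by (simp add: power_0_left)
      qed
      moreover have "face h = face d + smult c (face g)"
        by (simp add: d_def face_diff face_scalar_mult)
      ultimately show ?thesis
        by (metis degree_add_le degree_smult_le le_trans)
    qed simp
  qed
  then show thesis by (intro that) blast
qed

text \<open>A nonzero \<open>q\<close> with face 0 would bound the degrees of faces, but the faces
  of the powers of \<open>c\<close> have unbounded degree.\<close>

lemma face_eq_0_imp_eq_0:
  fixes q :: "'x word \<Rightarrow>\<^sub>0 'k::field"
  assumes "wdeg f > 0" "q \<in> centralizer f" "q \<in> supported M" "face q = 0"
    and c: "c \<in> centralizer f" "c \<in> supported M" "degree (face c) > 0"
  shows "q = 0"
proof (rule ccontr)
  assume "q \<noteq> 0"
  then obtain N where N: "\<And>h. h \<in> centralizer f \<Longrightarrow> h \<in> supported M \<Longrightarrow> degree (face h) \<le> N"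
    using degree_face_bounded[OF assms(1-4)] by blast
  have "degree (face (c ^ Suc N)) \<le> N"
    using c by (intro N centralizer_power supported_power)
  moreover have "degree (face (c ^ Suc N)) = Suc N * degree (face c)"
    using c by (subst face_power, simp, subst degree_power_eq) auto
  moreover have "Suc N * 1 \<le> Suc N * degree (face c)"
    using c(3) by (intro mult_le_mono) auto
  ultimately show False by simp
qed

end

text \<open>The nonconstant face belongs to whichever member of \<open>H\<close> contains the
  extremal word, which may differ from \<open>f\<close>.\<close>

lemma ex_word_face_nonconstant:
  fixes H :: "('x::finite word \<Rightarrow>\<^sub>0 'k::field) set"
  assumes "finite H" "f \<in> H" "wdeg f > 0"
  obtains M F where "word_face M F" "H \<subseteq> supported M" "\<exists>h\<in>H. degree (word_face.face F h) > 0"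
proof -
  let ?U = "\<Union>(Poly_Mapping.keys ` H)"
  obtain w where w: "wlen w = wdeg f" "coef f w \<noteq> 0"
    using wdeg_witness[of f] assms(3) by (metis wdeg_zero less_irrefl)
  with assms have "w \<in> ?U - {0}" by (auto simp: in_keys_iff)
  then have "finite ?U" "?U - {0} \<noteq> {}" using assms(1) by (simp, blast)
  then obtain M F where MF: "word_face M F" "?U \<subseteq> M" "\<exists>w\<in>?U. w \<in> F \<and> w \<noteq> 0"
    by (rule ex_word_face)
  then obtain h u where h: "h \<in> H" "coef h u \<noteq> 0" "u \<in> F" "u \<noteq> 0"
    by (auto simp: in_keys_iff)
  show thesis
  proof
    show "word_face M F" by fact
    show "H \<subseteq> supported M" using MF(2) by (auto simp: supported_def)
    show "\<exists>h\<in>H. degree (word_face.face F h) > 0"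
      using word_face.degree_face_pos[OF MF(1)] h by blast
  qed
qed

text \<open>The face of the commutator vanishes because k[t] is commutative, and the face map is
  injective here.\<close>

theorem centralizer_commutative:
  fixes f g h :: "'x::finite word \<Rightarrow>\<^sub>0 'k::field"
  assumes f: "wdeg f > 0" and gh: "g \<in> centralizer f" "h \<in> centralizer f"
  shows "g * h = h * g"
proof -
  obtain M F where MF: "word_face M F" "{f, g, h} \<subseteq> supported M"
    "\<exists>k\<in>{f, g, h}. degree (word_face.face F k) > 0"
    using ex_word_face_nonconstant[of "{f, g, h}" f] f by auto
  interpret word_face M F by (rule MF(1))
  obtain k where k: "k \<in> centralizer f" "k \<in> supported M" "degree (face k) > 0"
    using MF gh centralizer_self by blast
  have "g * h - h * g = 0"
  proof (rule face_eq_0_imp_eq_0[OF f _ _ _ k])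
    show "g * h - h * g \<in> centralizer f" using gh by (intro centralizer_diff centralizer_mult)
    show "g * h - h * g \<in> supported M" using MF(2) by (intro supported_diff supported_mult) auto
    show "face (g * h - h * g) = 0"
      using MF(2) by (simp add: face_diff face_mult mult.commute)
  qed
  then show ?thesis by simp
qed

section \<open>Coefficients in the polynomial variable\<close>

definition tcoef :: "nat \<Rightarrow> ('x word \<Rightarrow>\<^sub>0 'k::field poly) \<Rightarrow> 'x word \<Rightarrow>\<^sub>0 'k" where
  "tcoef i r = Poly_Mapping.map (\<lambda>p. coeff p i) r"

definition tbound :: "nat \<Rightarrow> ('x word \<Rightarrow>\<^sub>0 'k::field poly) \<Rightarrow> bool" where
  "tbound n r \<longleftrightarrow> (\<forall>w. degree (coef r w) \<le> n)"

lemma coef_tcoef [simp]: "coef (tcoef i r) w = coeff (coef r w) i"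
  by (simp add: tcoef_def Poly_Mapping.map.rep_eq when_def)

lemma tcoef_add: "tcoef i (r + s) = tcoef i r + tcoef i s"
  by (rule poly_mapping_eqI) (simp add: lookup_add)

lemma tcoef_diff: "tcoef i (r - s) = tcoef i r - tcoef i s"
  by (rule poly_mapping_eqI) (simp add: lookup_minus)

lemma tcoef_zero [simp]: "tcoef i 0 = 0"
  by (rule poly_mapping_eqI) simp

lemma tcoef_scalar [simp]: "tcoef i (scalar p) = scalar (coeff p i)"
  by (rule poly_mapping_eqI) (simp add: lookup_single when_def)

lemma tcoef_const_poly: "tcoef i (const_poly f) = (if i = 0 then f else 0)"
  by (rule poly_mapping_eqI) (simp add: coeff_pCons split: nat.split)

lemma tcoef_0_mult: "tcoef 0 (r * s) = tcoef 0 r * tcoef 0 s"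
  by (rule poly_mapping_eqI) (simp add: coef_mult coeff_sum coeff_mult_0)

lemma tcoef_const_poly_mult: "tcoef i (const_poly f * r) = f * tcoef i r"
  by (rule poly_mapping_eqI) (simp add: coef_mult coeff_sum)

lemma tcoef_mult_const_poly: "tcoef i (r * const_poly f) = tcoef i r * f"
  by (rule poly_mapping_eqI) (simp add: coef_mult coeff_sum mult.commute)

lemma tcoef_scalar_mult: "tcoef i (scalar q * r) = (\<Sum>j\<le>i. scalar (coeff q j) * tcoef (i - j) r)"
  by (rule poly_mapping_eqI) (simp add: lookup_sum coeff_mult)

lemma tcoef_eqI: "(\<And>i. tcoef i r = tcoef i s) \<Longrightarrow> r = s"
  by (intro poly_mapping_eqI poly_eqI) (metis coef_tcoef)

lemma tbound_tcoef: "tbound n r \<Longrightarrow> n < i \<Longrightarrow> tcoef i r = 0"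
  by (rule poly_mapping_eqI) (simp, metis coeff_eq_0 le_less_trans tbound_def)

lemma tbound_0_imp_const_poly: "tbound 0 r \<Longrightarrow> r = const_poly (tcoef 0 r)"
  by (rule tcoef_eqI) (simp add: tcoef_const_poly tbound_tcoef)

lemma ex_tdegree:
  assumes "r \<noteq> 0"
  obtains n where "tbound n r" "tcoef n r \<noteq> 0"
proof -
  let ?D = "(\<lambda>w. degree (coef r w)) ` Poly_Mapping.keys r"
  have "?D \<noteq> {}" using assms by simp
  then have "Max ?D \<in> ?D" by (intro Max_in) auto
  then obtain w where w: "w \<in> Poly_Mapping.keys r" "degree (coef r w) = Max ?D" by (metis imageE)
  have "degree (coef r u) \<le> Max ?D" for u
    by (cases "coef r u = 0") (auto intro!: Max_ge simp: in_keys_iff)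
  then have "tbound (Max ?D) r" by (simp add: tbound_def)
  moreover have "coef (tcoef (Max ?D) r) w \<noteq> 0"
    using w(1) by (simp add: in_keys_iff flip: w(2))
  then have "tcoef (Max ?D) r \<noteq> 0" by (metis lookup_zero)
  ultimately show thesis by (rule that)
qed

lemma coeff_mult_top:
  assumes "degree p \<le> m" "degree q \<le> n"
  shows "coeff (p * q) (m + n) = coeff p m * coeff q n"
proof -
  have "coeff (p * q) (m + n) = (\<Sum>i\<le>m + n. if i = m then coeff p m * coeff q n else 0)"
    unfolding coeff_mult
  proof (rule sum.cong)
    fix i assume "i \<in> {..m + n}"
    then show "coeff p i * coeff q (m + n - i) = (if i = m then coeff p m * coeff q n else 0)"
      using assms coeff_eq_0[of p i] coeff_eq_0[of q "m + n - i"]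
      by (cases i m rule: linorder_cases) auto
  qed simp
  then show ?thesis by simp
qed

lemma tcoef_mult_top:
  assumes "tbound m r" "tbound n s"
  shows "tcoef (m + n) (r * s) = tcoef m r * tcoef n s"
  using assms
  by (intro poly_mapping_eqI) (simp add: coef_mult coeff_sum tbound_def coeff_mult_top)

lemma tbound_mult: "tbound m r \<Longrightarrow> tbound n s \<Longrightarrow> tbound (m + n) (r * s)"
  unfolding tbound_def coef_mult
  by (intro allI degree_sum_le) (auto intro: le_trans[OF degree_mult_le] add_mono)

text \<open>The coefficients of the right-hand side at positive powers of t are scalars. So the top
  coefficients of \<open>e\<close> and \<open>h\<close> in t have a nonzero scalar product, and
  since degrees add, each has degree 0.\<close>

lemma factor_top_tcoef_scalar:
  fixes c :: "'x word \<Rightarrow>\<^sub>0 'k::field"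
  assumes eq: "e * h = const_poly c - scalar p" and p: "degree p > 0"
    and m: "tbound m e" "tcoef m e \<noteq> 0"
  obtains \<epsilon> where "\<epsilon> \<noteq> 0" "tcoef m e = scalar \<epsilon>"
proof -
  have "tcoef (degree p) (e * h) = scalar (- lead_coeff p)"
    using p by (simp add: eq tcoef_diff tcoef_const_poly single_uminus)
  then have nz: "tcoef (degree p) (e * h) \<noteq> 0" using p by auto
  then have "h \<noteq> 0" by auto
  then obtain n where n: "tbound n h" "tcoef n h \<noteq> 0" by (rule ex_tdegree)
  have "degree p \<le> m + n"
    using nz tbound_tcoef[OF tbound_mult[OF m(1) n(1)]] by (metis not_less)
  with p have "m + n > 0" by linarith
  then have "tcoef m e * tcoef n h = scalar (- coeff p (m + n))"
    by (auto simp: eq tcoef_diff tcoef_const_poly single_uminus simp flip: tcoef_mult_top[OF m(1) n(1)])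
  then have "wdeg (tcoef m e * tcoef n h) = 0" by simp
  then have "wdeg (tcoef m e) = 0" using m(2) n(2) by (simp add: wdeg_mult)
  from wdeg_0_imp_scalar[OF this] m(2) show thesis
    by (intro that[of "coef (tcoef m e) 0"]) auto
qed

text \<open>As \<open>c\<close> commutes with \<open>a\<close> and \<open>b\<close>, it maps their
  right ideal into itself, and cancelling \<open>q\<close> gives \<open>c * e = e * c'\<close>, with
  \<open>c\<close> read as a constant in t. The scalar top coefficient of \<open>e\<close> forces
  \<open>c'\<close> to equal \<open>c\<close>; comparing coefficients in t gives the claim.\<close>

lemma gcd_tcoef_commute:
  fixes e :: "'x word \<Rightarrow>\<^sub>0 'k::field poly"
  assumes e: "primitive e" "q \<noteq> 0" "scalar q * e = a * u + b * v" "a = e * a'" "b = e * b'"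
    and m: "tbound m e" "tcoef m e = scalar \<epsilon>" "\<epsilon> \<noteq> 0"
    and comm: "const_poly c * a = a * const_poly c" "const_poly c * b = b * const_poly c"
  shows "tcoef i e * c = c * tcoef i e"
proof -
  let ?c = "const_poly c"
  have "scalar q * (?c * e) = ?c * (a * u + b * v)"
    by (simp add: scalar_left_commute flip: e(3))
  also have "\<dots> = (?c * a) * u + (?c * b) * v"
    by (simp add: distrib_left mult.assoc)
  also have "\<dots> = e * (a' * ?c * u + b' * ?c * v)"
    unfolding comm by (simp add: e(4,5) distrib_left mult.assoc)
  finally obtain c' where c': "?c * e = e * c'"
    using primitive_cancel[OF e(1,2)] by blast
  have "c' = ?c"
  proof (cases "c' = 0")
    case True
    then have "?c * e = 0" using c' by simp
    with primitive_nonzero[OF e(1)] show ?thesis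
      using True by (metis free_mult_eq_0_iff)
  next
    case False
    then obtain n where n: "tbound n c'" "tcoef n c' \<noteq> 0" by (rule ex_tdegree)
    \<comment> \<open>The left side is the coefficient of \<open>c * e\<close>, which has t-degree
      at most \<open>m\<close>; hence \<open>n\<close> must be 0.\<close>
    have top: "c * tcoef (m + n) e = scalar \<epsilon> * tcoef n c'"
      using tcoef_mult_top[OF m(1) n(1)] by (simp add: m(2) flip: c' tcoef_const_poly_mult)
    have "n = 0"
    proof (rule ccontr)
      assume "n \<noteq> 0"
      then have "tcoef (m + n) e = 0" using tbound_tcoef[OF m(1)] by simp
      with top n(2) m(3) show False
        by (metis free_mult_eq_0_iff mult_zero_right scalar_eq_0_iff)
    qed
    with top have "scalar \<epsilon> * tcoef 0 c' = scalar \<epsilon> * c"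
      by (simp add: m(2) scalar_central)
    then have "tcoef 0 c' = c" using m(3) by (simp add: free_mult_left_cancel)
    with n(1) \<open>n = 0\<close> show ?thesis using tbound_0_imp_const_poly by metis
  qed
  then show ?thesis
    using c' by (metis tcoef_const_poly_mult tcoef_mult_const_poly)
qed

section \<open>Left modules avoiding a commutative subring\<close>

definition module_over :: "'a::ring_1 set \<Rightarrow> 'a set \<Rightarrow> bool" where
  "module_over C N \<longleftrightarrow> 0 \<in> N \<and> (\<forall>x\<in>N. \<forall>y\<in>N. x + y \<in> N) \<and> (\<forall>c\<in>C. \<forall>x\<in>N. c * x \<in> N)"

text \<open>By Zorn's lemma. For a \<open>scalar_ring\<close>, such an \<open>N\<close> complements
  \<open>C\<close> up to multiplication by nonzero elements of \<open>C\<close>; it replaces a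
  complement over the fraction field of \<open>C\<close>.\<close>

lemma maximal_module_avoiding:
  fixes C :: "'a::ring_1 set"
  obtains N where "module_over C N" "N \<inter> C \<subseteq> {0}"
    "\<And>N'. module_over C N' \<Longrightarrow> N' \<inter> C \<subseteq> {0} \<Longrightarrow> N \<subseteq> N' \<Longrightarrow> N' = N"
proof -
  let ?\<A> = "{N. module_over C N \<and> N \<inter> C \<subseteq> {0}}"
  have "\<exists>N\<in>?\<A>. \<forall>X\<in>?\<A>. N \<subseteq> X \<longrightarrow> X = N"
  proof (rule subset_Zorn_nonempty)
    have "{0} \<in> ?\<A>" by (simp add: module_over_def)
    then show "?\<A> \<noteq> {}" by blast
  next
    fix \<C> assume ne: "\<C> \<noteq> {}" and chain: "subset.chain ?\<A> \<C>"
    then have sub: "\<And>N. N \<in> \<C> \<Longrightarrow> module_over C N \<and> N \<inter> C \<subseteq> {0}"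
      and cmp: "\<And>N N'. N \<in> \<C> \<Longrightarrow> N' \<in> \<C> \<Longrightarrow> N \<subseteq> N' \<or> N' \<subseteq> N"
      by (auto simp: subset_chain_def)
    have "module_over C (\<Union>\<C>)"
      unfolding module_over_def
    proof (intro conjI ballI)
      show "0 \<in> \<Union>\<C>" using ne sub by (auto simp: module_over_def)
    next
      fix x y assume "x \<in> \<Union>\<C>" "y \<in> \<Union>\<C>"
      then obtain N\<^sub>1 N\<^sub>2 where "N\<^sub>1 \<in> \<C>" "x \<in> N\<^sub>1" "N\<^sub>2 \<in> \<C>" "y \<in> N\<^sub>2" by blast
      with cmp[of N\<^sub>1 N\<^sub>2] obtain N where N: "N \<in> \<C>" "x \<in> N" "y \<in> N" by auto
      then have "x + y \<in> N" using sub[OF N(1)] by (simp add: module_over_def)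
      with N(1) show "x + y \<in> \<Union>\<C>" by blast
    next
      fix c x assume "c \<in> C" "x \<in> \<Union>\<C>"
      then show "c * x \<in> \<Union>\<C>" using sub by (auto simp: module_over_def)
    qed
    moreover have "\<Union>\<C> \<inter> C \<subseteq> {0}" using sub by blast
    ultimately show "\<Union>\<C> \<in> ?\<A>" by blast
  qed
  then obtain N where "N \<in> ?\<A>" "\<forall>X\<in>?\<A>. N \<subseteq> X \<longrightarrow> X = N" ..
  then show thesis by (intro that[of N]) simp_all
qed

text \<open>This is N[t], with k[t]<X> regarded as polynomials in t over k<X>.\<close>

definition poly_ext :: "('x word \<Rightarrow>\<^sub>0 'k::field) set \<Rightarrow> ('x word \<Rightarrow>\<^sub>0 'k poly) set" where
  "poly_ext N = {r. \<forall>i. tcoef i r \<in> N}"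

locale scalar_ring =
  fixes C :: "('x word \<Rightarrow>\<^sub>0 'k::field) set"
  assumes scalar_mem: "scalar c \<in> C"
    and add_mem: "x \<in> C \<Longrightarrow> y \<in> C \<Longrightarrow> x + y \<in> C"
    and mult_mem: "x \<in> C \<Longrightarrow> y \<in> C \<Longrightarrow> x * y \<in> C"
    and commute: "x \<in> C \<Longrightarrow> y \<in> C \<Longrightarrow> x * y = y * x"
begin

lemma module_over_self: "module_over C C"
  using scalar_mem[of 0] by (simp add: module_over_def add_mem mult_mem)

lemma module_uminus:
  assumes "module_over C N" "x \<in> N"
  shows "- x \<in> N"
proof -
  have "scalar (- 1) * x \<in> N" using assms scalar_mem by (auto simp: module_over_def)
  then show ?thesis by (simp add: single_uminus)
qed

lemma poly_ext_add:
  "module_over C N \<Longrightarrow> r \<in> poly_ext N \<Longrightarrow> s \<in> poly_ext N \<Longrightarrow> r + s \<in> poly_ext N"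
  by (simp add: poly_ext_def module_over_def tcoef_add)

lemma poly_ext_diff:
  "module_over C N \<Longrightarrow> r \<in> poly_ext N \<Longrightarrow> s \<in> poly_ext N \<Longrightarrow> r - s \<in> poly_ext N"
  using module_uminus[of N] unfolding poly_ext_def module_over_def
  by (simp add: tcoef_diff) (metis diff_conv_add_uminus)

lemma poly_ext_scalar_mult:
  assumes N: "module_over C N" and r: "r \<in> poly_ext N"
  shows "scalar q * r \<in> poly_ext N"
proof -
  have "(\<Sum>j\<in>A. scalar (coeff q j) * tcoef (i - j) r) \<in> N" if "finite A" for i A
    using that
  proof induction
    case empty
    show ?case using N by (simp add: module_over_def)
  next
    case (insert j A)
    have "scalar (coeff q j) * tcoef (i - j) r \<in> N"
      using N r scalar_mem by (simp add: module_over_def poly_ext_def)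
    with insert N show ?case by (simp add: module_over_def)
  qed
  then show ?thesis by (simp add: poly_ext_def tcoef_scalar_mult)
qed

lemma poly_ext_const_mult:
  "module_over C N \<Longrightarrow> c \<in> C \<Longrightarrow> r \<in> poly_ext N \<Longrightarrow> const_poly c * r \<in> poly_ext N"
  by (simp add: poly_ext_def module_over_def tcoef_const_poly_mult)

lemma const_poly_mem_poly_ext: "module_over C N \<Longrightarrow> x \<in> N \<Longrightarrow> const_poly x \<in> poly_ext N"
  by (simp add: poly_ext_def module_over_def tcoef_const_poly)

lemma poly_ext_Int_trivial:
  "N \<inter> C \<subseteq> {0} \<Longrightarrow> r \<in> poly_ext N \<Longrightarrow> r \<in> poly_ext C \<Longrightarrow> r = 0"
  unfolding poly_ext_def by (intro tcoef_eqI) auto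

text \<open>If no nonzero multiple of \<open>a\<close> fell into C + N, then N + C a would still
  avoid \<open>C\<close>. Maximality would put \<open>a\<close> into \<open>N\<close>, where the
  multiplier 1 already works.\<close>

lemma ex_complement_multiple:
  assumes N: "module_over C N" "N \<inter> C \<subseteq> {0}"
    and max: "\<And>N'. module_over C N' \<Longrightarrow> N' \<inter> C \<subseteq> {0} \<Longrightarrow> N \<subseteq> N' \<Longrightarrow> N' = N"
  shows "\<exists>c\<in>C. c \<noteq> 0 \<and> (\<exists>x\<in>C. \<exists>n\<in>N. c * a = x + n)"
proof (rule ccontr)
  assume contra: "\<not> ?thesis"
  define N' where "N' = {n + c * a | n c. n \<in> N \<and> c \<in> C}"
  have mem: "n + c * a \<in> N'" if "n \<in> N" "c \<in> C" for n c using that by (auto simp: N'_def)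
  have one: "1 \<in> C" using scalar_mem[of 1] by simp
  have zero: "0 \<in> C" "0 \<in> N" using scalar_mem[of 0] N(1) by (simp_all add: module_over_def)
  have "module_over C N'"
    unfolding module_over_def
  proof (intro conjI ballI)
    show "0 \<in> N'" using mem[of 0 0] zero by simp
  next
    fix x y assume "x \<in> N'" "y \<in> N'"
    then obtain n c n' c' where "x = n + c * a" "y = n' + c' * a" "n \<in> N" "n' \<in> N" "c \<in> C" "c' \<in> C"
      by (auto simp: N'_def)
    then show "x + y \<in> N'"
      using mem[of "n + n'" "c + c'"] N(1) add_mem by (simp add: module_over_def algebra_simps)
  next
    fix d x assume "d \<in> C" "x \<in> N'"
    then obtain n c where "x = n + c * a" "n \<in> N" "c \<in> C" by (auto simp: N'_def)
    then show "d * x \<in> N'"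
      using mem[of "d * n" "d * c"] N(1) mult_mem \<open>d \<in> C\<close>
      by (simp add: module_over_def distrib_left mult.assoc)
  qed
  moreover have "N' \<inter> C \<subseteq> {0}"
  proof
    fix x assume "x \<in> N' \<inter> C"
    then obtain n c where x: "x \<in> C" "x = n + c * a" "n \<in> N" "c \<in> C" by (auto simp: N'_def)
    have "c * a = x + (- n)" using x(2) by simp
    then have "c = 0" using contra x module_uminus[OF N(1)] by blast
    with x N(2) show "x \<in> {0}" by auto
  qed
  moreover have "N \<subseteq> N'"
  proof
    fix n assume "n \<in> N"
    with mem[of n 0] zero show "n \<in> N'" by simp
  qed
  ultimately have "N' = N" by (rule max)
  then have "a \<in> N" using mem[of 0 1] zero one by simp
  then have "1 * a = 0 + a" "a \<in> N" by simp_all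
  with contra zero one show False by (metis zero_neq_one)
qed

text \<open>Single words are covered by the previous lemma. For sums the two multipliers are
  multiplied together, which uses that \<open>C\<close> is commutative.\<close>

lemma ex_poly_ext_multiple:
  assumes N: "module_over C N" "N \<inter> C \<subseteq> {0}"
    and max: "\<And>N'. module_over C N' \<Longrightarrow> N' \<inter> C \<subseteq> {0} \<Longrightarrow> N \<subseteq> N' \<Longrightarrow> N' = N"
  shows "\<exists>c\<in>C. c \<noteq> 0 \<and> (\<exists>x\<in>poly_ext C. \<exists>n\<in>poly_ext N. const_poly c * r = x + n)"
    (is "?D r")
proof -
  note C = module_over_self
  have add: "?D (r + s)" if rs: "?D r" "?D s" for r s
  proof -
    from rs obtain c x n where c: "c \<in> C" "c \<noteq> 0" "x \<in> poly_ext C" "n \<in> poly_ext N"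
      "const_poly c * r = x + n" by blast
    from rs obtain d y k where d: "d \<in> C" "d \<noteq> 0" "y \<in> poly_ext C" "k \<in> poly_ext N"
      "const_poly d * s = y + k" by blast
    have "const_poly (c * d) * (r + s) = const_poly (d * c) * r + const_poly (c * d) * s"
      using commute[OF c(1) d(1)] by (simp add: distrib_left)
    also have "\<dots> = const_poly d * (const_poly c * r) + const_poly c * (const_poly d * s)"
      by (simp add: const_poly_mult mult.assoc)
    also have "\<dots> = (const_poly d * x + const_poly c * y) + (const_poly d * n + const_poly c * k)"
      unfolding c(5) d(5) by (simp add: distrib_left)
    finally show ?thesis
      using c d N(1) C free_mult_nonzero[OF c(2) d(2)]
      by (blast intro: mult_mem poly_ext_add poly_ext_const_mult)
  qed
  have single: "?D (Poly_Mapping.single w q)" for w q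
  proof -
    obtain c x n where c: "c \<in> C" "c \<noteq> 0" "x \<in> C" "n \<in> N" "c * Poly_Mapping.single w 1 = x + n"
      using ex_complement_multiple[OF assms] by blast
    have "Poly_Mapping.single w q = scalar q * const_poly (Poly_Mapping.single w 1)"
      by (rule poly_mapping_eqI) (simp add: lookup_single when_def)
    then have "const_poly c * Poly_Mapping.single w q =
        scalar q * const_poly (c * Poly_Mapping.single w 1)"
      by (simp add: const_poly_mult scalar_left_commute)
    also have "\<dots> = scalar q * const_poly x + scalar q * const_poly n"
      by (simp add: c(5) const_poly_add distrib_left)
    finally show ?thesis
      using c N(1) C by (blast intro: poly_ext_scalar_mult const_poly_mem_poly_ext)
  qed
  have "?D (\<Sum>w\<in>A. Poly_Mapping.single w (coef r w))" if "finite A" for A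
    using that
  proof induction
    case empty
    show ?case using single[of 0 0] by simp
  next
    case (insert w A)
    then show ?case using add single by simp
  qed
  from this[of "Poly_Mapping.keys r"]
  have "?D (\<Sum>w\<in>Poly_Mapping.keys r. Poly_Mapping.single w (coef r w))" by simp
  also have "(\<Sum>w\<in>Poly_Mapping.keys r. Poly_Mapping.single w (coef r w)) = r"
    by (rule poly_mapping_eqI) (simp add: lookup_sum lookup_single when_def in_keys_iff)
  finally show ?thesis .
qed

end

section \<open>Centralizers are polynomial rings\<close>

text \<open>The face map is multiplicative only on \<open>M\<close>, while \<open>r\<close> and
  \<open>s\<close> are arbitrary. After multiplication by some \<open>c'\<close> in \<open>C\<close>
  they split along C[t] and N[t], both stable under the two generators. Only the C[t] part meets
  \<open>scalar p\<close>; there the face map applies and kills the generators, leaving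
  \<open>face c' * p = 0\<close>.\<close>

lemma (in word_face) face_ideal_proper:
  fixes C :: "('x word \<Rightarrow>\<^sub>0 'k::field) set"
  assumes "scalar_ring C" and supp: "C \<subseteq> supported M"
    and inj: "\<And>x. x \<in> C \<Longrightarrow> face x = 0 \<Longrightarrow> x = 0"
    and fg: "f \<in> C" "g \<in> C"
    and eq: "scalar p = (const_poly f - scalar (face f)) * r + (const_poly g - scalar (face g)) * s"
  shows "p = 0"
proof -
  interpret scalar_ring C by fact
  note C = module_over_self
  obtain N where N: "module_over C N" "N \<inter> C \<subseteq> {0}"
    and max: "\<And>N'. module_over C N' \<Longrightarrow> N' \<inter> C \<subseteq> {0} \<Longrightarrow> N \<subseteq> N' \<Longrightarrow> N' = N"
    using maximal_module_avoiding[of C] by blast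
  define a where "a = const_poly f - scalar (face f)"
  define b where "b = const_poly g - scalar (face g)"
  obtain c x n where c: "c \<in> C" "c \<noteq> 0" "x \<in> poly_ext C" "n \<in> poly_ext N"
    "const_poly c * r = x + n" using ex_poly_ext_multiple[OF N max, of r] by blast
  obtain d y k where d: "d \<in> C" "d \<noteq> 0" "y \<in> poly_ext C" "k \<in> poly_ext N"
    "const_poly d * s = y + k" using ex_poly_ext_multiple[OF N max, of s] by blast
  \<comment> \<open>A common multiplier, so that \<open>r\<close> and \<open>s\<close> split
    simultaneously.\<close>
  define c' where "c' = c * d"
  have c': "c' \<in> C" "c' \<noteq> 0"
    using c d by (simp_all add: c'_def mult_mem free_mult_nonzero)
  have r: "const_poly c' * r = const_poly d * x + const_poly d * n"
    using commute[OF c(1) d(1)]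
    by (simp add: c'_def const_poly_mult mult.assoc c(5) distrib_left)
  have s: "const_poly c' * s = const_poly c * y + const_poly c * k"
    by (simp add: c'_def const_poly_mult mult.assoc d(5) distrib_left)
  have comm: "const_poly c' * (const_poly h - scalar q) = (const_poly h - scalar q) * const_poly c'"
    if "h \<in> C" for h q
    using commute[OF c'(1) that]
    by (simp add: left_diff_distrib right_diff_distrib scalar_central flip: const_poly_mult)
  have ideal: "(const_poly h - scalar q) * z \<in> poly_ext L"
    if "module_over C L" "h \<in> C" "z \<in> poly_ext L" for L h q z
    using that by (simp add: left_diff_distrib poly_ext_diff poly_ext_const_mult poly_ext_scalar_mult)
  have "const_poly c' * scalar p = a * (const_poly c' * r) + b * (const_poly c' * s)"
    using comm[OF fg(1), of "face f"] comm[OF fg(2), of "face g"]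
    by (simp add: eq a_def b_def distrib_left flip: mult.assoc)
  then have split: "const_poly c' * scalar p - (a * (const_poly d * x) + b * (const_poly c * y)) =
      a * (const_poly d * n) + b * (const_poly c * k)"
    unfolding r s by (simp add: algebra_simps)
  have Y: "a * (const_poly d * n) + b * (const_poly c * k) \<in> poly_ext N"
    unfolding a_def b_def using N(1) c d fg
    by (intro poly_ext_add ideal poly_ext_const_mult)
  have X: "a * (const_poly d * x) + b * (const_poly c * y) \<in> poly_ext C"
    unfolding a_def b_def using C c d fg
    by (intro poly_ext_add ideal poly_ext_const_mult)
  have Z: "const_poly c' * scalar p \<in> poly_ext C"
    using C c'(1) by (simp add: poly_ext_scalar_mult const_poly_mem_poly_ext flip: scalar_central)
  \<comment> \<open>The difference lies in C[t], and by \<open>split\<close> also in N[t].\<close>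
  have zero: "const_poly c' * scalar p - (a * (const_poly d * x) + b * (const_poly c * y)) = 0"
  proof (rule poly_ext_Int_trivial[OF N(2)])
    show "const_poly c' * scalar p - (a * (const_poly d * x) + b * (const_poly c * y)) \<in> poly_ext N"
      unfolding split by (rule Y)
  qed (rule poly_ext_diff[OF C Z X])
  have ext_supp: "z \<in> supported M" if z: "z \<in> poly_ext C" for z
  proof (rule supportedI)
    fix w assume "coef z w \<noteq> 0"
    then obtain i where "coef (tcoef i z) w \<noteq> 0" by (metis coef_tcoef leading_coeff_neq_0)
    moreover have "tcoef i z \<in> supported M" using z supp by (auto simp: poly_ext_def)
    ultimately show "w \<in> M" by (rule supportedD[rotated])
  qed
  have kill: "face_poly ((const_poly h - scalar (face h)) * z) = 0"
    if "h \<in> C" "z \<in> poly_ext C" for h z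
  proof -
    have "const_poly h - scalar (face h) \<in> supported M"
      using supp that by (auto intro: supported_diff supported_const_poly supported_scalar)
    then show ?thesis
      using ext_supp[OF that(2)] by (simp add: face_poly_mult face_poly_diff face_def)
  qed
  have "face_poly (const_poly c' * scalar p) =
      face_poly (a * (const_poly d * x)) + face_poly (b * (const_poly c * y))"
    using zero by (simp add: face_poly_add)
  also have "\<dots> = 0"
    unfolding a_def b_def using fg c d C by (simp add: kill poly_ext_const_mult)
  finally have "face c' * p = 0"
    using c'(1) supp
    by (simp add: face_poly_mult supported_const_poly supported_scalar subset_iff face_def)
  then show ?thesis using inj c' by auto
qed

lemma wdeg_diff_scalar:
  fixes f :: "'x word \<Rightarrow>\<^sub>0 'r::ab_group_add"
  assumes "wdeg f > 0"
  shows "wdeg (f - scalar c) = wdeg f"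
proof -
  have "f \<noteq> 0" using assms by auto
  have "below (wdeg f) (f - (f - scalar c))"
    using assms by (auto simp: below_def lookup_single when_def)
  then show ?thesis using wdeg_diff_less(2) \<open>f \<noteq> 0\<close> by blast
qed

lemma wdeg_const_poly [simp]: "wdeg (const_poly f) = wdeg f"
proof -
  have "Poly_Mapping.keys (const_poly f) = Poly_Mapping.keys f" by (auto simp: in_keys_iff)
  then show ?thesis by (simp add: wdeg_def)
qed

lemma scalar_ring_centralizer_supported:
  fixes f :: "'x::finite word \<Rightarrow>\<^sub>0 'k::field"
  assumes "word_face M F" "wdeg f > 0"
  shows "scalar_ring (centralizer f \<inter> supported M)"
proof -
  interpret word_face M F by fact
  have "x + y \<in> supported M" if "x \<in> supported M" "y \<in> supported M" for x y :: "'x word \<Rightarrow>\<^sub>0 'k"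
    using supported_diff[OF that(1) supported_diff[OF supported_scalar that(2)], of 0] by simp
  then show ?thesis
    by unfold_locales
      (auto intro: centralizer_scalar centralizer_add centralizer_mult supported_scalar
        supported_mult centralizer_commutative[OF assms(2)])
qed

lemma centralizer_divide:
  fixes f f\<^sub>0 g :: "'x::finite word \<Rightarrow>\<^sub>0 'k::field"
  assumes f0: "wdeg f\<^sub>0 > 0" and f: "f \<in> centralizer f\<^sub>0" "wdeg f > 0"
    and min: "\<And>h. h \<in> centralizer f\<^sub>0 \<Longrightarrow> wdeg h > 0 \<Longrightarrow> wdeg f \<le> wdeg h"
    and g: "g \<in> centralizer f\<^sub>0" "wdeg g > 0"
  shows "\<exists>\<alpha> \<beta> y. g - scalar \<beta> = (f - scalar \<alpha>) * y"
proof -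
  obtain M F where MF: "word_face M F" "{f, g} \<subseteq> supported M"
    "\<exists>k\<in>{f, g}. degree (word_face.face F k) > 0"
    using ex_word_face_nonconstant[of "{f, g}" f] f by auto
  interpret word_face M F by (rule MF(1))
  define C where "C = centralizer f\<^sub>0 \<inter> supported M"
  have fg: "f \<in> C" "g \<in> C" using f g MF(2) by (auto simp: C_def)
  have ring: "scalar_ring C"
    unfolding C_def by (rule scalar_ring_centralizer_supported[OF MF(1) f0])
  obtain k where k: "k \<in> {f, g}" "degree (face k) > 0" using MF(3) by blast
  have inj: "x = 0" if "x \<in> C" "face x = 0" for x
    using face_eq_0_imp_eq_0[OF f0, of x k] that k fg by (auto simp: C_def)
  define a where "a = const_poly f - scalar (face f)"
  define b where "b = const_poly g - scalar (face g)"
  have wdeg_ab: "wdeg a = wdeg f" "wdeg b = wdeg g"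
    using f g by (simp_all add: a_def b_def wdeg_diff_scalar)
  have comm: "const_poly x * (const_poly y - scalar q) = (const_poly y - scalar q) * const_poly x"
    if "x * y = y * x" for x y :: "'x word \<Rightarrow>\<^sub>0 'k" and q
    using that by (simp add: left_diff_distrib right_diff_distrib scalar_central flip: const_poly_mult)
  have "f * g = g * f" using centralizer_commutative[OF f0 f(1) g(1)] .
  then have "const_poly f * b = b * const_poly f"
    unfolding b_def by (rule comm)
  \<comment> \<open>This product is the common right multiple that starts Euclid's
    algorithm.\<close>
  then have "a * b = b * a"
    using scalar_central[of "face f" b] by (simp add: a_def left_diff_distrib right_diff_distrib)
  moreover have "a * b \<noteq> 0" using wdeg_ab f g by (auto simp: free_mult_eq_0_iff)
  ultimately obtain e q u v a' b' where e: "primitive e" "q \<noteq> 0" "scalar q * e = a * u + b * v"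
    "a = e * a'" "b = e * b'"
    using common_multiple_imp_has_gcd[of a b b a] unfolding has_gcd_def by blast
  have "e \<noteq> 0" using primitive_nonzero[OF e(1)] .
  then obtain m where m: "tbound m e" "tcoef m e \<noteq> 0" by (rule ex_tdegree)
  \<comment> \<open>The top coefficient of \<open>e\<close> is read off from \<open>k\<close>, the
    one of \<open>f\<close> and \<open>g\<close> known to have a nonconstant face.\<close>
  obtain \<epsilon> where \<epsilon>: "\<epsilon> \<noteq> 0" "tcoef m e = scalar \<epsilon>"
  proof -
    have "\<exists>h. e * h = const_poly k - scalar (face k)"
      using k(1) e(4,5) by (auto simp: a_def b_def)
    then show thesis using factor_top_tcoef_scalar[OF _ k(2) m] that by blast
  qed
  have ei: "tcoef i e \<in> centralizer f\<^sub>0" for i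
    using gcd_tcoef_commute[OF e m(1) \<epsilon>(2,1), of f\<^sub>0 i]
      comm[of f\<^sub>0 f "face f"] comm[of f\<^sub>0 g "face g"] centralizerD[OF f(1)] centralizerD[OF g(1)]
    by (simp add: a_def b_def centralizer_def)
  \<comment> \<open>Were \<open>e\<close> a scalar, the right ideal of \<open>a\<close> and
    \<open>b\<close> would contain a nonzero element of k[t], against
    \<open>face_ideal_proper\<close>.\<close>
  have "wdeg e > 0"
  proof (rule ccontr)
    assume "\<not> wdeg e > 0"
    then obtain e0 where e0: "e = scalar e0" using wdeg_0_imp_scalar by blast
    have "q * e0 = 0"
    proof (rule face_ideal_proper[OF ring _ _ fg])
      show "C \<subseteq> supported M" by (simp add: C_def)
      show "x = 0" if "x \<in> C" "face x = 0" for x using inj that .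
      show "scalar (q * e0) = (const_poly f - scalar (face f)) * u + (const_poly g - scalar (face g)) * v"
        using e(3) by (simp only: e0 scalar_mult_scalar a_def b_def)
    qed
    with e(2) e0 \<open>e \<noteq> 0\<close> show False by simp
  qed
  \<comment> \<open>Some coefficient of \<open>e\<close> in t contains a longest word of
    \<open>e\<close>; it lies in the centralizer and has positive degree, so minimality of
    \<open>f\<close> applies to it.\<close>
  have "wdeg f \<le> wdeg e"
  proof -
    obtain w where w: "wlen w = wdeg e" "coef e w \<noteq> 0" using wdeg_witness[OF \<open>e \<noteq> 0\<close>] .
    define i where "i = degree (coef e w)"
    have "coef (tcoef i e) w \<noteq> 0" using w(2) by (simp add: i_def)
    then have "wdeg (tcoef i e) > 0" using le_wdeg[of "tcoef i e" w] w(1) \<open>wdeg e > 0\<close> by simp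
    then have "wdeg f \<le> wdeg (tcoef i e)" by (rule min[OF ei])
    also have "\<dots> \<le> wdeg e"
    proof -
      have "tcoef i e \<noteq> 0" using \<open>wdeg (tcoef i e) > 0\<close> by auto
      then obtain u where "wlen u = wdeg (tcoef i e)" "coef (tcoef i e) u \<noteq> 0"
        by (rule wdeg_witness)
      then show ?thesis using le_wdeg[of e u] by force
    qed
    finally show ?thesis .
  qed
  moreover have "a' \<noteq> 0" using \<open>a * b \<noteq> 0\<close> e(4) by auto
  then have "wdeg f = wdeg e + wdeg a'"
    using e(4) \<open>e \<noteq> 0\<close> by (simp add: wdeg_mult flip: wdeg_ab(1))
  ultimately have "wdeg a' = 0" by simp
  then obtain h0 where h0: "a' = scalar h0" using wdeg_0_imp_scalar by blast
  obtain w where w: "wlen w = wdeg f" "coef f w \<noteq> 0"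
    using wdeg_witness[of f] f(2) by (metis wdeg_zero less_irrefl)
  have "w \<noteq> 0" using w(1) f(2) by auto
  \<comment> \<open>At a nonempty word \<open>scalar (face f)\<close> contributes nothing, so
    \<open>h0\<close> divides a nonzero constant.\<close>
  then have "[:coef f w:] = coef a w" by (simp add: a_def lookup_minus lookup_single when_def)
  also have "\<dots> = coef e w * h0" by (simp add: e(4) h0)
  finally have "is_unit h0"
    using w(2) by (metis dvd_mult_right is_unit_pCons_iff)
  then obtain h1 where h1: "h0 * h1 = 1" by (metis dvdE)
  have "e = a * scalar h1"
    by (simp add: e(4) h0 mult.assoc scalar_mult_scalar h1)
  then have "b = a * (scalar h1 * b')" using e(5) by (simp add: mult.assoc)
  \<comment> \<open>Setting t = 0 is a ring homomorphism; \<alpha> and \<beta> are the constant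
    terms of the two faces.\<close>
  then have "tcoef 0 b = tcoef 0 a * tcoef 0 (scalar h1 * b')"
    using tcoef_0_mult by metis
  then show ?thesis
    by (auto simp: a_def b_def tcoef_diff tcoef_const_poly)
qed

section \<open>Evaluation of one-variable polynomials\<close>

definition poly_eval :: "('x word \<Rightarrow>\<^sub>0 'k::field) \<Rightarrow> 'k poly \<Rightarrow> 'x word \<Rightarrow>\<^sub>0 'k" where
  "poly_eval f p = fold_coeffs (\<lambda>c r. scalar c + f * r) p 0"

lemma poly_eval_0 [simp]: "poly_eval f 0 = 0"
  by (simp add: poly_eval_def)

lemma poly_eval_pCons [simp]: "poly_eval f (pCons c p) = scalar c + f * poly_eval f p"
  by (cases "p = 0 \<and> c = 0") (auto simp: poly_eval_def)

lemma poly_eval_add: "poly_eval f (p + q) = poly_eval f p + poly_eval f q"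
  by (induction p q rule: poly_induct2) (simp_all add: scalar_add algebra_simps)

lemma poly_eval_smult: "poly_eval f (smult c p) = scalar c * poly_eval f p"
  by (induction p) (simp_all add: distrib_left scalar_mult_scalar scalar_left_commute)

lemma poly_eval_mult: "poly_eval f (p * q) = poly_eval f p * poly_eval f q"
  by (induction p) (simp_all add: poly_eval_add poly_eval_smult distrib_right mult.assoc)

text \<open>By Horner's scheme: if the tail is nonzero, \<open>f\<close> times its value has
  positive degree and cannot cancel the scalar \<open>c\<close>.\<close>

lemma poly_eval_nonzero:
  assumes "wdeg f > 0" "p \<noteq> 0"
  shows "poly_eval f p \<noteq> 0"
  using assms(2)
proof (induction p)
  case (pCons c p)
  show ?case
  proof (cases "p = 0")
    case False
    with pCons.IH assms(1) have "wdeg (f * poly_eval f p) > 0"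
      by (subst wdeg_mult) auto
    then have "f * poly_eval f p \<noteq> scalar (- c)" by (metis less_irrefl wdeg_scalar)
    then show ?thesis by (simp add: add_eq_0_iff single_uminus)
  qed (use pCons in simp)
qed simp

lemma poly_eval_inj: "wdeg f > 0 \<Longrightarrow> inj (poly_eval f)"
proof (rule injI)
  fix p q assume "wdeg f > 0" "poly_eval f p = poly_eval f q"
  moreover have "poly_eval f p = poly_eval f (p - q) + poly_eval f q"
    by (simp flip: poly_eval_add)
  ultimately show "p = q" using poly_eval_nonzero[of f "p - q"] by auto
qed

lemma poly_eval_mem_centralizer:
  assumes "f \<in> centralizer g"
  shows "poly_eval f p \<in> centralizer g"
proof (induction p)
  case 0
  show ?case by (simp add: centralizer_zero)
next
  case (pCons c p)
  then show ?case
    using assms by (simp add: centralizer_add centralizer_mult centralizer_scalar)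
qed

theorem centralizer_eq_range_poly_eval:
  fixes f\<^sub>0 :: "'x::finite word \<Rightarrow>\<^sub>0 'k::field"
  assumes f0: "wdeg f\<^sub>0 > 0"
  obtains f where "wdeg f > 0" "centralizer f\<^sub>0 = range (poly_eval f)"
proof -
  obtain f where f: "f \<in> centralizer f\<^sub>0" "wdeg f > 0"
    and min: "\<And>h. h \<in> centralizer f\<^sub>0 \<Longrightarrow> wdeg h > 0 \<Longrightarrow> wdeg f \<le> wdeg h"
    using ex_has_least_nat[of "\<lambda>h. h \<in> centralizer f\<^sub>0 \<and> wdeg h > 0" f\<^sub>0 wdeg]
      centralizer_self f0 by blast
  have "g \<in> range (poly_eval f)" if "g \<in> centralizer f\<^sub>0" for g
    using that
  proof (induction "wdeg g" arbitrary: g rule: less_induct)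
    case less
    show ?case
    proof (cases "wdeg g = 0")
      case True
      then obtain c where "g = scalar c" using wdeg_0_imp_scalar by blast
      then have "g = poly_eval f [:c:]" by simp
      then show ?thesis by blast
    next
      case False
      then obtain \<alpha> \<beta> y where y: "g - scalar \<beta> = (f - scalar \<alpha>) * y"
        using centralizer_divide[OF f0 f min less.prems] by auto
      let ?f = "f - scalar \<alpha>" and ?g = "g - scalar \<beta>"
      have wdeg_fg: "wdeg ?f = wdeg f" "wdeg ?g = wdeg g"
        using f(2) False by (simp_all add: wdeg_diff_scalar)
      have nz: "?f \<noteq> 0" "y \<noteq> 0" using wdeg_fg f(2) False y by auto
      have mem: "?f \<in> centralizer f\<^sub>0" "?g \<in> centralizer f\<^sub>0"
        using f(1) less.prems by (auto intro: centralizer_diff centralizer_scalar)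
      \<comment> \<open>The quotient inherits commutation with \<open>f\<^sub>0\<close> from
        \<open>?f\<close> and \<open>?g\<close>, since \<open>?f\<close> can be cancelled on the
        left.\<close>
      have "?f * (y * f\<^sub>0) = ?g * f\<^sub>0" by (simp add: y mult.assoc)
      also have "\<dots> = f\<^sub>0 * (?f * y)" using centralizerD[OF mem(2)] by (simp only: y)
      also have "\<dots> = ?f * (f\<^sub>0 * y)" using centralizerD[OF mem(1)] by (simp only: flip: mult.assoc)
      finally have "y \<in> centralizer f\<^sub>0"
        using free_mult_left_cancel[OF nz(1)] by (simp add: centralizer_def)
      moreover have "wdeg g = wdeg f + wdeg y"
        using wdeg_mult[OF nz] wdeg_fg by (simp flip: y)
      ultimately obtain p where p: "y = poly_eval f p" using less.hyps[of y] f(2) by auto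
      have "g = scalar \<beta> + ?f * y" by (simp flip: y)
      \<comment> \<open>Division with remainder by \<open>f - scalar \<alpha>\<close>, rewritten as
        a polynomial identity in \<open>f\<close>.\<close>
      also have "\<dots> = poly_eval f ([:\<beta>:] + [:- \<alpha>, 1:] * p)"
        by (simp only: poly_eval_add poly_eval_mult) (simp add: p single_uminus algebra_simps)
      finally show ?thesis by blast
    qed
  qed
  moreover have "range (poly_eval f) \<subseteq> centralizer f\<^sub>0"
    using poly_eval_mem_centralizer[OF f(1)] by blast
  ultimately show thesis using that f(2) by blast
qed

section \<open>Maximal commutative subalgebras as centralizers\<close>

lemma commutative_subalgebra_centralizer:
  fixes f :: "('x::finite, 'k::field) free_algebra"
  assumes "wdeg f > 0"
  shows "free_algebra.commutative_subalgebra (centralizer f)"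
  unfolding free_algebra.commutative_subalgebra_def free_algebra.subalgebra_def
    free_algebra.subspace_def
  using centralizer_commutative[OF assms]
  by (auto simp: free_scale_eq_single_mult centralizer_zero centralizer_one
      intro: centralizer_add centralizer_mult centralizer_scalar)

lemma maximal_commutative_subalgebra_eq_centralizer:
  fixes B :: "('x::finite, 'k::field) free_algebra set"
  assumes "free_algebra.maximal_commutative_subalgebra B"
  obtains f where "wdeg f > 0" "B = centralizer f"
proof -
  have comm: "free_algebra.commutative_subalgebra B"
    and max: "\<And>C. free_algebra.commutative_subalgebra C \<Longrightarrow> B \<subseteq> C \<Longrightarrow> B = C"
    using assms unfolding free_algebra.maximal_commutative_subalgebra_def by blast+
  have "\<exists>f\<in>B. wdeg f > 0"
  proof (rule ccontr)
    assume scalars: "\<not> ?thesis"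
    \<comment> \<open>An arbitrary generator, which exists because types are nonempty. A subalgebra
      of scalars alone would lie properly inside its commutative centralizer.\<close>
    let ?x = "free_var undefined :: ('x, 'k) free_algebra"
    have x: "wdeg ?x > 0"
      using le_wdeg[of ?x "Word [undefined]"] by (simp add: free_var_def)
    have "B \<subseteq> centralizer ?x"
    proof
      fix g assume "g \<in> B"
      with scalars obtain c where "g = scalar c" using wdeg_0_imp_scalar by blast
      then show "g \<in> centralizer ?x" using centralizer_scalar by simp
    qed
    then have "B = centralizer ?x" by (rule max[OF commutative_subalgebra_centralizer[OF x]])
    then show False using scalars x centralizer_self by blast
  qed
  then obtain f where f: "f \<in> B" "wdeg f > 0" by blast
  have "B \<subseteq> centralizer f"
    using comm f(1) unfolding free_algebra.commutative_subalgebra_def centralizer_def by blast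
  then have "B = centralizer f" by (rule max[OF commutative_subalgebra_centralizer[OF f(2)]])
  with f(2) show thesis by (rule that)
qed

theorem theorem1p3:
  fixes B :: "('s::finite, 'k::field) free_algebra set"
  assumes "free_algebra.maximal_commutative_subalgebra B"
  shows "algebra_isomorphic free_scale B smult (UNIV :: 'k poly set)"
proof -
  obtain f\<^sub>0 where f0: "wdeg f\<^sub>0 > 0" "B = centralizer f\<^sub>0"
    using maximal_commutative_subalgebra_eq_centralizer[OF assms] .
  obtain f where f: "wdeg f > 0" "centralizer f\<^sub>0 = range (poly_eval f)"
    using centralizer_eq_range_poly_eval[OF f0(1)] .
  have B: "B = range (poly_eval f)" using f0 f by simp
  \<comment> \<open>Evaluation maps k[z] onto \<open>B\<close>, whereas the isomorphism is to start
    from \<open>B\<close>.\<close>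
  let ?\<phi> = "inv (poly_eval f)"
  have inj: "inj (poly_eval f)" using poly_eval_inj[OF f(1)] .
  have inv: "?\<phi> (poly_eval f p) = p" for p using inj by simp
  have "bij_betw ?\<phi> B UNIV"
    unfolding B by (rule bij_betw_inv_into) (simp add: bij_betw_def inj)
  moreover have "?\<phi> 1 = 1"
    using inv[of 1] by (simp add: one_pCons)
  moreover have "?\<phi> (x + y) = ?\<phi> x + ?\<phi> y \<and> ?\<phi> (x * y) = ?\<phi> x * ?\<phi> y"
    if "x \<in> B" "y \<in> B" for x y
    using that unfolding B by (auto simp: inv simp flip: poly_eval_add poly_eval_mult)
  moreover have "?\<phi> (free_scale c x) = smult c (?\<phi> x)" if "x \<in> B" for c x
    using that unfolding B by (auto simp: inv free_scale_eq_single_mult simp flip: poly_eval_smult)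
  ultimately show ?thesis unfolding algebra_isomorphic_def by blast
qed

end
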